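(* Consider the truncated queueing-inventory process with generator $\hat H$ described in the context (truncation level $M\ge1$), assumed stable, i.e. possessing a stationary probability vector $\Phi=(\Phi^{(0)},\Phi^{(1)},\Phi^{(2)},\dots)$ with $\Phi\hat H=\mathbf 0$ and $\Phi\mathbf e=1$, partitioned according to the orbit level $\iota_1$. Let $\mathbb{R}$ be the minimal nonnegative solution of $\mathbb{R}^2\mathbb{H}_{M0}+\mathbb{R}\mathbb{H}_{M1}+\mathbb{H}_0=\mathbf 0$. Then $$\Phi^{(\iota_1)}=\begin{cases}\Phi^{(0)}\,\Omega_{\iota_1}, & \iota_1=0,1,2,\dots,M,\\ \Phi^{(0)}\,\Omega_M\,\mathbb{R}^{\iota_1-M}, & \iota_1>M,\end{cases}$$ where $$\Omega_{\iota_1}=\begin{cases} I, & \iota_1=0,\\ \prod_{j=1}^{\iota_1}\mathbb{H}_0K_j=(\mathbb{H}_0K_1)(\mathbb{H}_0K_2)\cdots(\mathbb{H}_0K_{\iota_1}), & \iota_1=1,2,\dots,M,\end{cases}$$ $$K_j=\begin{cases}\bigl[-(\mathbb{H}_{j1}+\mathbb{H}_0K_{j+1}\mathbb{H}_{j+1,0})\bigr]^{-1}, & j=1,2,\dots,M-1,\\ \bigl[-(\mathbb{H}_{M1}+\mathbb{R}\,\mathbb{H}_{M0})\bigr]^{-1}, & j=M,\end{cases}$$ and $\Phi^{(0)}$ is obtained by solving the system $$\Phi^{(0)}\bigl(\mathbb{H}_{01}+\Omega_1\mathbb{H}_{10}\bigr)=\mathbf 0,\qquad \sum_{\iota_1=0}^{\infty}\Phi^{(\iota_1)}\mathbf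 e=1 .$$
   Context: Model. Integers $c\ge 1$ (number of identical servers), $N$ (waiting hall size, customers in service included), $S$ (maximal inventory), $s$ (reorder level), $Q=S-s$, with $c\le N$ and $c\le s<Q$. Real parameters $\lambda,\theta,\mu,\beta,\eta>0$ and $0<p\le 1$. $\mathbf e$ is a column vector of ones and $I$ the identity matrix. Phase set. $E$ is the set of tuples $(\iota_2,\iota_3,\iota_4,\iota_5,\iota_6)$ of nonnegative integers ($\iota_2$ = inventory level, $\iota_3$ = servers on vacation, $\iota_4$ = busy servers, $\iota_5$ = idle servers, $\iota_6$ = customers in the waiting hall) such that, with $n=c-\iota_3$ the number of servers not on vacation: $0\le\iota_2\le S$, $0\le n\le c$, $0\le \iota_6\le N$, $\iota_4=\min(n,\iota_2,\iota_6)$, $\iota_5=n-\iota_4$, and either $n\ge1$ and $n\le\max(\iota_2,\iota_6)$, or $n=0$ and $\iota_2\in\{0,Q\}$. Since $\iota_4,\iota_5$ are determined by the rest, a phase is written $(\iota_2,n,\iota_6)$ below. Process. The state is $(\iota_1,\text{phase})$ with $\iota_1\in\{0,1,2,\dots\}$ the number of orbiting customers. From $(\iota_1;\iota_2,n,\iota_6)$ the transitions are: (1) primary arrival: if $\iota_6<N$, rate $\lambda$ to $(\iota_1;\iota_2,n,\iota_6+1)$; if $\iota_6=N$, rate $p\lambda$ to $(\iota_1+1;\iota_2,n,N)$ (with probability $1-p$ the customer is lost); (2) retrial: if $\iota_1\ge1$ and $\iota_6<N$, rate $\iota_1\theta$ to $(\iota_1-1;\iota_2,n,\iota_6+1)$;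 (3) service completion: if $\iota_4=\min(n,\iota_2,\iota_6)\ge1$, rate $\iota_4\mu$ to $(\iota_1;\iota_2-1,n',\iota_6-1)$, where $n'=n$ if $n\le\max(\iota_2-1,\iota_6-1)$ and $n'=n-1$ otherwise (a server starts a vacation); (4) replenishment: if $\iota_2\le s$, rate $\beta$ to $(\iota_1;\iota_2+Q,n,\iota_6)$; (5) vacation completion: if $n<c$ and $n+1\le\max(\iota_2,\iota_6)$, rate $\eta$ to $(\iota_1;\iota_2,n+1,\iota_6)$ (otherwise a returning server takes another vacation). Blocks. Ordering states by $\iota_1$, the generator is block tridiagonal: $\mathbb{H}_0$ is the $E\times E$ matrix of rates from orbit level $\iota_1$ to $\iota_1+1$, $\mathbb{H}_{\iota_1 0}$ (also written $\mathbb{H}_{\iota_1,0}$) that from $\iota_1$ to $\iota_1-1$ ($\iota_1\ge1$), and $\mathbb{H}_{\iota_1 1}$ that within level $\iota_1$, including the diagonal entries that make all row sums of the generator zero. Truncated generator. For $M\ge1$, $\hat H$ is the generator obtained by replacing $\mathbb{H}_{\iota_1 0}$ by $\mathbb{H}_{M0}$ and $\mathbb{H}_{\iota_1 1}$ by $\mathbb{H}_{M1}$ for all $\iota_1\ge M$. *)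

theory Defs
  imports Complex_Main "Jordan_Normal_Form.Gauss_Jordan_Elimination"
begin

record qis_params =
  num_servers :: nat     (* c *)
  hall_size :: nat       (* N *)
  max_inv :: nat         (* S *)
  reorder_lvl :: nat     (* s *)
  arr_rate :: real       (* lambda *)
  retrial_rate :: real   (* theta *)
  serv_rate :: real      (* mu *)
  repl_rate :: real      (* beta *)
  vac_rate :: real       (* eta *)
  join_prob :: real      (* p *)

definition order_qty :: "qis_params \<Rightarrow> nat" where
  "order_qty P = max_inv P - reorder_lvl P"

definition admissible :: "qis_params \<Rightarrow> bool" where
  "admissible P \<longleftrightarrow>
     1 \<le> num_servers P \<and> num_servers P \<le> hall_size P \<and>
     num_servers P \<le> reorder_lvl P \<and> reorder_lvl P < order_qty P \<and>
     0 < arr_rate P \<and> 0 < retrial_rate P \<and> 0 < serv_rate P \<and>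
     0 < repl_rate P \<and> 0 < vac_rate P \<and> 0 < join_prob P \<and> join_prob P \<le> 1"


text \<open>A phase is a triple \<open>(i, n, m)\<close>: inventory level, number of servers not on vacation,
  customers in the waiting hall.  The number of servers on vacation is \<open>c - n\<close>, that of busy
  servers is \<open>min n (min i m)\<close>, and that of idle servers is the difference of \<open>n\<close> and the latter;
  being functions of the triple they are not recorded.\<close>

type_synonym phase = "nat \<times> nat \<times> nat"
type_synonym state = "nat \<times> phase"

definition phase_set :: "qis_params \<Rightarrow> phase set" where
  "phase_set P = {(i, n, m). i \<le> max_inv P \<and> n \<le> num_servers P \<and> m \<le> hall_size P \<and>
     (1 \<le> n \<and> n \<le> max i m \<or> n = 0 \<and> (i = 0 \<or> i = order_qty P))}"

definition busy :: "phase \<Rightarrow> nat" where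
  "busy = (\<lambda>(i, n, m). min n (min i m))"

text \<open>Transition rates of the queueing-inventory process; the first component of a state is the
  number of orbiting customers.  The summands are: primary arrival to the hall, primary arrival to
  the orbit, retrial, service completion, replenishment, vacation completion.\<close>

fun rate :: "qis_params \<Rightarrow> state \<Rightarrow> state \<Rightarrow> real" where
  "rate P (k, i, n, m) t =
     (if m < hall_size P \<and> t = (k, i, n, m + 1) then arr_rate P else 0)
   + (if m = hall_size P \<and> t = (k + 1, i, n, m) then join_prob P * arr_rate P else 0)
   + (if 1 \<le> k \<and> m < hall_size P \<and> t = (k - 1, i, n, m + 1) then real k * retrial_rate P else 0)
   + (if 1 \<le> busy (i, n, m) \<and>
         t = (k, i - 1, (if n \<le> max (i - 1) (m - 1) then n else n - 1), m - 1)
      then real (busy (i, n, m)) * serv_rate P else 0)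
   + (if i \<le> reorder_lvl P \<and> t = (k, i + order_qty P, n, m) then repl_rate P else 0)
   + (if n < num_servers P \<and> n + 1 \<le> max i m \<and> t = (k, i, n + 1, m) then vac_rate P else 0)"

declare rate.simps [simp del]

text \<open>The sum over orbit levels up to \<open>k + 1\<close> is the total rate out of a state at level \<open>k\<close>
  (lemma \<open>rate_target\<close> below).\<close>

definition gen :: "qis_params \<Rightarrow> state \<Rightarrow> state \<Rightarrow> real" where
  "gen P x y = rate P x y
     - (if x = y then (\<Sum>z\<in>{..fst x + 1} \<times> phase_set P. rate P x z) else 0)"

lemma rate_target:
  assumes "admissible P" "x \<in> phase_set P" "rate P (k, x) (l, y) \<noteq> 0"
  shows "y \<in> phase_set P" "l \<le> k + 1" "k \<le> l + 1" "(l, y) \<noteq> (k, x)"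
proof -
  obtain i n m where x: "x = (i, n, m)" by (cases x)
  from assms(1) have A: "0 < num_servers P" "num_servers P \<le> hall_size P"
      "num_servers P \<le> reorder_lvl P" "reorder_lvl P + reorder_lvl P < max_inv P"
    by (auto simp: admissible_def order_qty_def)
  from assms(3) consider
      "m < hall_size P" "l = k" "y = (i, n, m + 1)"
    | "l = k + 1" "y = (i, n, m)"
    | "1 \<le> k" "m < hall_size P" "l = k - 1" "y = (i, n, m + 1)"
    | "1 \<le> n" "1 \<le> i" "1 \<le> m" "l = k"
      "y = (i - 1, (if n \<le> max (i - 1) (m - 1) then n else n - 1), m - 1)"
    | "i \<le> reorder_lvl P" "l = k" "y = (i + order_qty P, n, m)"
    | "n < num_servers P" "n + 1 \<le> max i m" "l = k" "y = (i, n + 1, m)"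
    unfolding x rate.simps busy_def by (simp split: if_splits)
  then have "y \<in> phase_set P \<and> l \<le> k + 1 \<and> k \<le> l + 1 \<and> (l, y) \<noteq> (k, x)"
  proof cases
    case 4
    then show ?thesis using assms(2) A unfolding x by (cases "n = 1") (auto simp: phase_set_def)
  qed (use assms(2) A in \<open>auto simp: x phase_set_def order_qty_def\<close>)
  then show "y \<in> phase_set P" "l \<le> k + 1" "k \<le> l + 1" "(l, y) \<noteq> (k, x)" by auto
qed

lemma finite_phase_set: "finite (phase_set P)"
  by (rule finite_subset[of _ "{..max_inv P} \<times> {..num_servers P} \<times> {..hall_size P}"])
     (auto simp: phase_set_def)

lemma gen_row_sum:
  assumes "x \<in> phase_set P"
  shows "(\<Sum>y\<in>{..k + 1} \<times> phase_set P. gen P (k, x) y) = 0"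
  using assms by (simp add: gen_def sum_subtractf finite_phase_set)


text \<open>Matrices are indexed by positions in a repetition-free list of the phases.\<close>

definition phases :: "qis_params \<Rightarrow> phase list" where
  "phases P = filter (\<lambda>x. x \<in> phase_set P)
     (List.product [0..<Suc (max_inv P)]
        (List.product [0..<Suc (num_servers P)] [0..<Suc (hall_size P)]))"

lemma set_phases: "set (phases P) = phase_set P"
  by (auto simp: phases_def phase_set_def)

lemma distinct_phases: "distinct (phases P)"
  unfolding phases_def by (intro distinct_filter distinct_product) auto

definition nph :: "qis_params \<Rightarrow> nat" where
  "nph P = length (phases P)"

lemma nph_eq_card: "nph P = card (phase_set P)"
  by (metis nph_def set_phases distinct_phases distinct_card)

definition gen_block :: "qis_params \<Rightarrow> nat \<Rightarrow> nat \<Rightarrow> real mat" where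
  "gen_block P k l =
     mat (nph P) (nph P) (\<lambda>(a, b). gen P (k, phases P ! a) (l, phases P ! b))"

definition H_up :: "qis_params \<Rightarrow> real mat" where  (* level-independent, see gen_block_up *)
  "H_up P = gen_block P 0 1"

definition H_down :: "qis_params \<Rightarrow> nat \<Rightarrow> real mat" where  (* meaningful for k >= 1 only *)
  "H_down P k = gen_block P k (k - 1)"

definition H_loc :: "qis_params \<Rightarrow> nat \<Rightarrow> real mat" where
  "H_loc P k = gen_block P k k"

lemma gen_block_up: "gen_block P k (k + 1) = H_up P"
  unfolding H_up_def gen_block_def
proof (intro cong_mat refl, clarify)
  fix a b
  obtain i n m where "phases P ! a = (i, n, m)" by (cases "phases P ! a")
  then show "gen P (k, phases P ! a) (k + 1, phases P ! b) =
      gen P (0, phases P ! a) (1, phases P ! b)"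
    by (auto simp: gen_def rate.simps)
qed

definition trunc_gen :: "qis_params \<Rightarrow> nat \<Rightarrow> nat \<Rightarrow> nat \<Rightarrow> real mat" where
  "trunc_gen P M k l =
     (if l = k + 1 then H_up P
      else if l = k then H_loc P (min k M)
      else if k = l + 1 then H_down P (min k M)
      else 0\<^sub>m (nph P) (nph P))"


text \<open>Row vectors are one-row matrices; the order on matrices is entrywise.\<close>

definition ones :: "qis_params \<Rightarrow> real mat" where
  "ones P = mat (nph P) 1 (\<lambda>_. 1)"

definition stationary_distribution :: "qis_params \<Rightarrow> nat \<Rightarrow> (nat \<Rightarrow> real mat) \<Rightarrow> bool" where
  "stationary_distribution P M \<Phi> \<longleftrightarrow>
     (\<forall>k. \<Phi> k \<in> carrier_mat 1 (nph P) \<and> 0\<^sub>m 1 (nph P) \<le> \<Phi> k) \<and>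
     (\<forall>l. \<forall>b<nph P. (\<lambda>k. (\<Phi> k * trunc_gen P M k l) $$ (0, b)) sums 0) \<and>
     (\<lambda>k. (\<Phi> k * ones P) $$ (0, 0)) sums 1"

definition nonneg_solution :: "qis_params \<Rightarrow> nat \<Rightarrow> real mat \<Rightarrow> bool" where
  "nonneg_solution P M X \<longleftrightarrow>
     X \<in> carrier_mat (nph P) (nph P) \<and> 0\<^sub>m (nph P) (nph P) \<le> X \<and>
     (X ^\<^sub>m 2) * H_down P M + X * H_loc P M + H_up P = 0\<^sub>m (nph P) (nph P)"

definition minimal_nonneg_solution :: "qis_params \<Rightarrow> nat \<Rightarrow> real mat \<Rightarrow> bool" where
  "minimal_nonneg_solution P M R \<longleftrightarrow>
     nonneg_solution P M R \<and> (\<forall>X. nonneg_solution P M X \<longrightarrow> R \<le> X)"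

definition minv :: "real mat \<Rightarrow> real mat" where  (* unspecified on singular matrices *)
  "minv A = the (mat_inverse A)"

text \<open>\<open>K_mat P M R j\<close> is meaningful for \<open>1 \<le> j \<le> M\<close> only.\<close>

function K_mat :: "qis_params \<Rightarrow> nat \<Rightarrow> real mat \<Rightarrow> nat \<Rightarrow> real mat" where
  "K_mat P M R j =
     (if j < M then minv (- (H_loc P j + H_up P * K_mat P M R (j + 1) * H_down P (j + 1)))
      else minv (- (H_loc P M + R * H_down P M)))"
  by pat_completeness auto
termination by (relation "measure (\<lambda>(P, M, R, j). M - j)") auto

declare K_mat.simps [simp del]

primrec Omega :: "qis_params \<Rightarrow> nat \<Rightarrow> real mat \<Rightarrow> nat \<Rightarrow> real mat" where
  "Omega P M R 0 = 1\<^sub>m (nph P)"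
| "Omega P M R (Suc k) = Omega P M R k * (H_up P * K_mat P M R (Suc k))"

definition level_vector ::
  "qis_params \<Rightarrow> nat \<Rightarrow> real mat \<Rightarrow> real mat \<Rightarrow> nat \<Rightarrow> real mat" where
  "level_vector P M R v k =
     (if k \<le> M then v * Omega P M R k else v * Omega P M R M * (R ^\<^sub>m (k - M)))"

end

theory Submission
  imports Defs "Jordan_Normal_Form.Determinant"
begin

text \<open>
  Let \<open>(A\<^sub>0, A\<^sub>1, A\<^sub>2)\<close> be the blocks of a level-homogeneous chain from which the level below is
  always reachable.  The matrix \<open>N\<close> of expected sojourn times in a level before the first visit to
  the level below is the limit of a monotone iteration; it satisfies
  \<open>N (- (A\<^sub>1 + A\<^sub>0 N A\<^sub>2)) = I\<close> and \<open>N A\<^sub>2\<close> is substochastic.  The same iteration shows that \<open>A\<^sub>0 N\<close>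
  lies below every nonnegative solution of the quadratic equation and that
  \<open>\<Phi>\<^bsub>k+1\<^esub> \<ge> \<Phi>\<^bsub>k\<^esub> A\<^sub>0 N\<close> for every nonnegative solution of the balance equations.  The defect
  \<open>D\<^bsub>k\<^esub> = \<Phi>\<^bsub>k+1\<^esub> - \<Phi>\<^bsub>k\<^esub> A\<^sub>0 N\<close> satisfies \<open>D\<^bsub>k\<^esub> = D\<^bsub>k+1\<^esub> A\<^sub>2 N\<close>, so the total mass of \<open>D\<^bsub>k\<^esub> A\<^sub>2\<close> is
  nondecreasing in \<open>k\<close>; as \<open>\<Phi>\<^bsub>k\<^esub>\<close> vanishes at infinity, \<open>D\<^bsub>k\<^esub> = 0\<close>.

  With \<open>A\<^sub>0 = 0\<close> the same facts apply to the chain censored on the levels from \<open>j\<close> on, which gives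
  the inverses \<open>K\<^bsub>j\<^esub>\<close> by downward induction.  For level 0, if \<open>v\<close> is a left null vector of the
  censored generator then so is its entrywise absolute value, and a nonnegative null vector vanishing
  at one phase vanishes wherever that phase can be reached from.  Since the phase \<open>(0, 0, 0)\<close> is
  reachable from everywhere within a level, the null space is one-dimensional.
\<close>

subsection \<open>Entrywise order and limits of matrices\<close>

lemma mult_mat_entry:
  fixes A B :: "'a :: comm_semiring_0 mat"
  assumes "A \<in> carrier_mat nr n" "B \<in> carrier_mat n nc" "i < nr" "j < nc"
  shows "(A * B) $$ (i, j) = (\<Sum>k<n. A $$ (i, k) * B $$ (k, j))"
  using assms by (auto simp: scalar_prod_def atLeast0LessThan intro!: sum.cong)

lemma mat_leI:
  assumes "A \<in> carrier_mat nr nc" "B \<in> carrier_mat nr nc"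
    and "\<And>i j. i < nr \<Longrightarrow> j < nc \<Longrightarrow> A $$ (i, j) \<le> B $$ (i, j)"
  shows "A \<le> B"
  using assms by (auto simp: less_eq_mat_def)

lemma mat_leD:
  assumes "A \<le> B" "B \<in> carrier_mat nr nc" "i < nr" "j < nc"
  shows "A $$ (i, j) \<le> B $$ (i, j)"
  using assms by (auto simp: less_eq_mat_def)

lemma mat_nonnegD:
  fixes A :: "real mat"
  assumes "0\<^sub>m nr nc \<le> A" "A \<in> carrier_mat nr nc" "i < nr" "j < nc"
  shows "0 \<le> A $$ (i, j)"
  using mat_leD[OF assms] assms(3,4) by simp

text \<open>The route is \<open>A * B \<le> A * B' \<le> A' * B'\<close>, which is why nonnegativity
  is asked of \<open>A\<close> and \<open>B'\<close>.\<close>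

lemma mult_mat_mono:
  fixes A A' B B' :: "real mat"
  assumes "A \<le> A'" "B \<le> B'" "0\<^sub>m nr n \<le> A" "0\<^sub>m n nc \<le> B'"
    and c: "A \<in> carrier_mat nr n" "A' \<in> carrier_mat nr n" "B \<in> carrier_mat n nc" "B' \<in> carrier_mat n nc"
  shows "A * B \<le> A' * B'"
proof (rule mat_leI)
  fix i j assume ij: "i < nr" "j < nc"
  show "(A * B) $$ (i, j) \<le> (A' * B') $$ (i, j)"
    unfolding mult_mat_entry[OF c(1,3) ij] mult_mat_entry[OF c(2,4) ij]
  proof (rule sum_mono)
    fix k assume "k \<in> {..<n}"
    then have k: "k < n" by simp
    show "A $$ (i, k) * B $$ (k, j) \<le> A' $$ (i, k) * B' $$ (k, j)"
      by (intro mult_mono' order_trans[OF mult_left_mono mult_right_mono]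
          mat_leD[OF assms(1) c(2) ij(1) k] mat_leD[OF assms(2) c(4) k ij(2)]
          mat_nonnegD[OF assms(3) c(1) ij(1) k] mat_nonnegD[OF assms(4) c(4) k ij(2)])
  qed
qed (use c in auto)

lemma mult_mat_nonneg:
  fixes A B :: "real mat"
  assumes "0\<^sub>m nr n \<le> A" "0\<^sub>m n nc \<le> B" "A \<in> carrier_mat nr n" "B \<in> carrier_mat n nc"
  shows "0\<^sub>m nr nc \<le> A * B"
  using mult_mat_mono[of "0\<^sub>m nr n" A "0\<^sub>m n nc" B nr n nc] assms by simp

lemma add_mat_mono:
  fixes A A' B B' :: "real mat"
  assumes "A \<le> A'" "B \<le> B'" "A' \<in> carrier_mat nr nc" "B' \<in> carrier_mat nr nc"
  shows "A + B \<le> A' + B'"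
  using assms by (auto simp: less_eq_mat_def intro: add_mono)

lemma smult_mat_mono:
  fixes A A' :: "real mat"
  assumes "A \<le> A'" "0 \<le> d"
  shows "d \<cdot>\<^sub>m A \<le> d \<cdot>\<^sub>m A'"
  using assms by (auto simp: less_eq_mat_def intro: mult_left_mono)

lemma row_sum_mult:
  fixes X Y :: "real mat"
  assumes "X \<in> carrier_mat nr n" "Y \<in> carrier_mat n m" "a < nr"
  shows "(\<Sum>b<m. (X * Y) $$ (a, b)) = (\<Sum>c<n. X $$ (a, c) * (\<Sum>b<m. Y $$ (c, b)))"
proof -
  have "(\<Sum>b<m. (X * Y) $$ (a, b)) = (\<Sum>b<m. \<Sum>c<n. X $$ (a, c) * Y $$ (c, b))"
    using mult_mat_entry[OF assms(1,2)] assms(3) by (intro sum.cong) auto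
  also have "\<dots> = (\<Sum>c<n. \<Sum>b<m. X $$ (a, c) * Y $$ (c, b))" by (rule sum.swap)
  finally show ?thesis by (simp add: sum_distrib_left)
qed

text \<open>The dimensions do not occur in the equations themselves and must be supplied for
  rewriting. Every factor but the first is square; the first may be a row vector.\<close>

lemmas mat_assoc = assoc_mult_mat[where n\<^sub>1 = m and n\<^sub>2 = n and n\<^sub>3 = n and n\<^sub>4 = n for m n]
lemmas mat_distrib = mult_add_distrib_mat[where nr = m and n = n and nc = n for m n]

text \<open>The type \<open>real mat\<close> does not fix dimensions, so they are part of this
  notion of entrywise convergence.\<close>

definition mat_tendsto :: "nat \<Rightarrow> nat \<Rightarrow> (nat \<Rightarrow> real mat) \<Rightarrow> real mat \<Rightarrow> bool" where
  "mat_tendsto nr nc X L \<longleftrightarrow>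
     (\<forall>t. X t \<in> carrier_mat nr nc) \<and> L \<in> carrier_mat nr nc \<and>
     (\<forall>i<nr. \<forall>j<nc. (\<lambda>t. X t $$ (i, j)) \<longlonglongrightarrow> L $$ (i, j))"

lemma mat_tendsto_carrier:
  assumes "mat_tendsto nr nc X L"
  shows "X t \<in> carrier_mat nr nc" "L \<in> carrier_mat nr nc"
    "dim_row (X t) = nr" "dim_col (X t) = nc" "dim_row L = nr" "dim_col L = nc"
  using assms unfolding mat_tendsto_def by (meson carrier_matD)+

lemma mat_tendsto_entry:
  "mat_tendsto nr nc X L \<Longrightarrow> i < nr \<Longrightarrow> j < nc \<Longrightarrow> (\<lambda>t. X t $$ (i, j)) \<longlonglongrightarrow> L $$ (i, j)"
  by (simp add: mat_tendsto_def)

lemma mat_tendsto_const: "A \<in> carrier_mat nr nc \<Longrightarrow> mat_tendsto nr nc (\<lambda>_. A) A"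
  by (auto simp: mat_tendsto_def)

lemma mat_tendsto_mult:
  assumes "mat_tendsto nr n X A" "mat_tendsto n nc Y B"
  shows "mat_tendsto nr nc (\<lambda>t. X t * Y t) (A * B)"
  unfolding mat_tendsto_def
proof (intro conjI allI impI)
  note c = mat_tendsto_carrier[OF assms(1)] mat_tendsto_carrier[OF assms(2)]
  fix i j assume ij: "i < nr" "j < nc"
  show "(\<lambda>t. (X t * Y t) $$ (i, j)) \<longlonglongrightarrow> (A * B) $$ (i, j)"
    unfolding mult_mat_entry[OF c(1,7) ij] mult_mat_entry[OF c(2,8) ij]
    using ij by (intro tendsto_sum tendsto_mult mat_tendsto_entry[OF assms(1)] mat_tendsto_entry[OF assms(2)]) auto
qed (intro mult_carrier_mat[where n = n] mat_tendsto_carrier[OF assms(1)] mat_tendsto_carrier[OF assms(2)])+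

lemma mat_tendsto_add:
  assumes "mat_tendsto nr nc X A" "mat_tendsto nr nc Y B"
  shows "mat_tendsto nr nc (\<lambda>t. X t + Y t) (A + B)"
  using mat_tendsto_carrier[OF assms(1)] mat_tendsto_carrier[OF assms(2)]
    mat_tendsto_entry[OF assms(1)] mat_tendsto_entry[OF assms(2)]
  by (subst mat_tendsto_def) (simp add: tendsto_add)

lemma mat_tendsto_smult:
  assumes "mat_tendsto nr nc X A"
  shows "mat_tendsto nr nc (\<lambda>t. d \<cdot>\<^sub>m X t) (d \<cdot>\<^sub>m A)"
  using mat_tendsto_carrier[OF assms] mat_tendsto_entry[OF assms]
  by (subst mat_tendsto_def) (simp add: tendsto_mult_left)

lemma mat_tendsto_Suc: "mat_tendsto nr nc X A \<Longrightarrow> mat_tendsto nr nc (\<lambda>t. X (Suc t)) A"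
  unfolding mat_tendsto_def by (auto intro: LIMSEQ_Suc)

lemma mat_tendsto_unique:
  assumes "mat_tendsto nr nc X A" "mat_tendsto nr nc X B"
  shows "A = B"
  using mat_tendsto_carrier[OF assms(1)] mat_tendsto_carrier[OF assms(2)]
    LIMSEQ_unique[OF mat_tendsto_entry[OF assms(1)] mat_tendsto_entry[OF assms(2)]]
  by (intro eq_matI) auto

lemma mat_tendsto_le:
  assumes "mat_tendsto nr nc X A" "\<And>t. X t \<le> B" "B \<in> carrier_mat nr nc"
  shows "A \<le> B"
proof (rule mat_leI)
  fix i j assume ij: "i < nr" "j < nc"
  show "A $$ (i, j) \<le> B $$ (i, j)"
    using assms(1) ij mat_leD[OF assms(2,3) ij]
    by (intro LIMSEQ_le_const2[of "\<lambda>t. X t $$ (i, j)"]) (auto simp: mat_tendsto_def)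
qed (use assms in \<open>auto simp: mat_tendsto_def\<close>)

lemma mat_tendsto_ge:
  assumes "mat_tendsto nr nc X A" "\<And>t. B \<le> X t" "B \<in> carrier_mat nr nc"
  shows "B \<le> A"
proof (rule mat_leI)
  fix i j assume ij: "i < nr" "j < nc"
  have "X t \<in> carrier_mat nr nc" for t using assms(1) by (simp add: mat_tendsto_def)
  then show "B $$ (i, j) \<le> A $$ (i, j)"
    using assms(1) ij mat_leD[OF assms(2) _ ij]
    by (intro LIMSEQ_le_const[of "\<lambda>t. X t $$ (i, j)"]) (auto simp: mat_tendsto_def)
qed (use assms in \<open>auto simp: mat_tendsto_def\<close>)

subsection \<open>Sojourn matrices of block-tridiagonal generators\<close>

text \<open>\<open>drain\<close> says, as an induction rule, that from every phase a path of
  positive off-diagonal entries of \<open>A1\<close> leads to a phase where \<open>A2\<close> has a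
  positive row sum. This keeps the sojourn times finite. Row sums are bounded by 0 rather than equal
  to it, and \<open>A0\<close> may be zero, so that censored blocks fit too.\<close>

locale qbd_blocks =
  fixes n :: nat and A0 A1 A2 :: "real mat"
  assumes carr [simp]: "A0 \<in> carrier_mat n n" "A1 \<in> carrier_mat n n" "A2 \<in> carrier_mat n n"
    and A0_nonneg: "0\<^sub>m n n \<le> A0"
    and A2_nonneg: "0\<^sub>m n n \<le> A2"
    and A1_offdiag: "\<And>i j. i < n \<Longrightarrow> j < n \<Longrightarrow> i \<noteq> j \<Longrightarrow> 0 \<le> A1 $$ (i, j)"
    and row_sums: "\<And>i. i < n \<Longrightarrow>
      (\<Sum>j<n. A0 $$ (i, j)) + (\<Sum>j<n. A1 $$ (i, j)) + (\<Sum>j<n. A2 $$ (i, j)) \<le> 0"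
    and drain: "\<And>C a. (\<And>b. b < n \<Longrightarrow> 0 < (\<Sum>j<n. A2 $$ (b, j)) \<Longrightarrow> C b) \<Longrightarrow>
      (\<And>a b. a < n \<Longrightarrow> b < n \<Longrightarrow> a \<noteq> b \<Longrightarrow> 0 < A1 $$ (a, b) \<Longrightarrow> C b \<Longrightarrow> C a) \<Longrightarrow> a < n \<Longrightarrow> C a"
begin

lemmas mult_carr [simp] = mult_carrier_mat[where n = n]
lemmas dims = carr[THEN carrier_matD(1)] carr[THEN carrier_matD(2)]

text \<open>A uniformization rate; it dominates the diagonal of \<open>A1\<close> and the row sums of \<open>A2\<close>.\<close>

definition d :: real where
  "d = 1 + (\<Sum>i<n. \<bar>A1 $$ (i, i)\<bar>) + (\<Sum>i<n. \<Sum>j<n. A2 $$ (i, j))"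

definition B :: "real mat" where "B = A1 + d \<cdot>\<^sub>m 1\<^sub>m n"

text \<open>The equation \<open>X * (- (A1 + A0 * X * A2)) = I\<close> says
  \<open>0 = I + X A1 + X A0 X A2\<close>; adding \<open>d X\<close> gives
  \<open>d X = I + X B + X A0 X A2\<close>, a fixed-point equation with nonnegative coefficients,
  which is iterated from 0.\<close>

primrec sojourn :: "nat \<Rightarrow> real mat" where
  "sojourn 0 = 0\<^sub>m n n"
| "sojourn (Suc t) =
     inverse d \<cdot>\<^sub>m (1\<^sub>m n + sojourn t * B + sojourn t * A0 * sojourn t * A2)"

lemma A2_entry: "i < n \<Longrightarrow> j < n \<Longrightarrow> 0 \<le> A2 $$ (i, j)"
  using mat_nonnegD[OF A2_nonneg] by simp

lemma A2_row_nonneg: "i < n \<Longrightarrow> 0 \<le> (\<Sum>j<n. A2 $$ (i, j))"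
  by (intro sum_nonneg) (auto intro: A2_entry)

lemma d_bounds:
  shows "1 \<le> d" "i < n \<Longrightarrow> \<bar>A1 $$ (i, i)\<bar> \<le> d" "i < n \<Longrightarrow> (\<Sum>j<n. A2 $$ (i, j)) \<le> d"
proof -
  have 1: "0 \<le> (\<Sum>i<n. \<bar>A1 $$ (i, i)\<bar>)" by (intro sum_nonneg) auto
  have 2: "0 \<le> (\<Sum>i<n. \<Sum>j<n. A2 $$ (i, j))" by (intro sum_nonneg) (auto intro: A2_entry)
  show "1 \<le> d" using 1 2 by (simp add: d_def)
  assume i: "i < n"
  have "\<bar>A1 $$ (i, i)\<bar> \<le> (\<Sum>i<n. \<bar>A1 $$ (i, i)\<bar>)"
    using member_le_sum[of i "{..<n}" "\<lambda>i. \<bar>A1 $$ (i, i)\<bar>"] i by simp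
  with 2 show "\<bar>A1 $$ (i, i)\<bar> \<le> d" by (simp add: d_def)
  have "(\<Sum>j<n. A2 $$ (i, j)) \<le> (\<Sum>i<n. \<Sum>j<n. A2 $$ (i, j))"
    using member_le_sum[of i "{..<n}" "\<lambda>i. \<Sum>j<n. A2 $$ (i, j)"] i A2_row_nonneg by simp
  with 1 show "(\<Sum>j<n. A2 $$ (i, j)) \<le> d" unfolding d_def by linarith
qed

lemma B_carr [simp]: "B \<in> carrier_mat n n" by (simp add: B_def)

lemma B_entry: "i < n \<Longrightarrow> j < n \<Longrightarrow> B $$ (i, j) = A1 $$ (i, j) + (if i = j then d else 0)"
  using dims by (simp add: B_def)

lemma B_nonneg: "0\<^sub>m n n \<le> B"
proof (rule mat_leI)
  fix i j assume "i < n" "j < n"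
  then show "(0\<^sub>m n n :: real mat) $$ (i, j) \<le> B $$ (i, j)"
    using d_bounds(2)[of i] by (auto simp: B_entry A1_offdiag)
qed auto

lemma sojourn_carr [simp]: "sojourn t \<in> carrier_mat n n"
proof (induction t)
  case (Suc t)
  then show ?case
    by simp
qed simp

declare sojourn.simps(2) [simp del]

lemma sojourn_Suc: "d \<cdot>\<^sub>m sojourn (Suc t) = 1\<^sub>m n + sojourn t * B + sojourn t * A0 * sojourn t * A2"
proof -
  have "d \<cdot>\<^sub>m sojourn (Suc t) =
      (d * inverse d) \<cdot>\<^sub>m (1\<^sub>m n + sojourn t * B + sojourn t * A0 * sojourn t * A2)"
    unfolding sojourn.simps by (intro eq_matI) auto
  then show ?thesis using d_bounds(1) by (intro eq_matI) auto
qed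

text \<open>All coefficients of the recursion are nonnegative, so its right-hand side is monotone in
  the iterate. Nonnegativity is carried along because monotonicity of products needs it.\<close>

lemma sojourn_mono: "0\<^sub>m n n \<le> sojourn t \<and> sojourn t \<le> sojourn (Suc t)"
proof (induction t)
  case 0
  have "0\<^sub>m n n \<le> sojourn (Suc 0)"
  proof -
    have "sojourn (Suc 0) = inverse d \<cdot>\<^sub>m 1\<^sub>m n"
      by (simp add: sojourn.simps(2) left_mult_zero_mat[where n = n and nr = n and nc = n])
    then show ?thesis using d_bounds(1) by (intro mat_leI[where nr = n and nc = n]) auto
  qed
  then show ?case by simp
next
  case (Suc t)
  let ?X = "sojourn t" and ?Y = "sojourn (Suc t)"
  have X: "0\<^sub>m n n \<le> ?X" "?X \<le> ?Y" using Suc by auto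
  then have Y: "0\<^sub>m n n \<le> ?Y" by (rule order_trans)
  have c: "?X \<in> carrier_mat n n" "?Y \<in> carrier_mat n n" by (rule sojourn_carr)+
  note nn = mult_mat_nonneg[where nr = n and n = n and nc = n]
  note mm = mult_mat_mono[where nr = n and n = n and nc = n]
  have 1: "?X * B \<le> ?Y * B" by (rule mm) (use X Y c B_nonneg in auto)
  have 2: "?X * A0 \<le> ?Y * A0" by (rule mm) (use X Y c A0_nonneg in auto)
  have 3: "0\<^sub>m n n \<le> ?X * A0" by (rule nn) (use X c A0_nonneg in auto)
  have 4: "?X * A0 * ?X \<le> ?Y * A0 * ?Y" by (rule mm) (use X Y 2 3 c in auto)
  have 5: "0\<^sub>m n n \<le> ?X * A0 * ?X" by (rule nn) (use X 3 c in auto)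
  have 6: "?X * A0 * ?X * A2 \<le> ?Y * A0 * ?Y * A2" by (rule mm) (use 4 5 c A2_nonneg in auto)
  have "inverse d \<cdot>\<^sub>m (1\<^sub>m n + ?X * B + ?X * A0 * ?X * A2) \<le>
      inverse d \<cdot>\<^sub>m (1\<^sub>m n + ?Y * B + ?Y * A0 * ?Y * A2)"
    by (intro smult_mat_mono add_mat_mono[of _ _ _ _ n n]) (use 1 6 d_bounds(1) c in auto)
  then have "sojourn (Suc t) \<le> sojourn (Suc (Suc t))"
    by (simp only: sojourn.simps(2)[of t, symmetric] sojourn.simps(2)[of "Suc t", symmetric])
  with Y show ?case by blast
qed

lemma sojourn_nonneg: "0\<^sub>m n n \<le> sojourn t"
  using sojourn_mono by blast

lemma sojourn_entry: "i < n \<Longrightarrow> j < n \<Longrightarrow> 0 \<le> sojourn t $$ (i, j)"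
  by (rule mat_nonnegD[OF sojourn_nonneg sojourn_carr])

lemma sojourn_entry_mono: "i < n \<Longrightarrow> j < n \<Longrightarrow> sojourn t $$ (i, j) \<le> sojourn (Suc t) $$ (i, j)"
  by (rule mat_leD[OF _ sojourn_carr]) (use sojourn_mono in auto)

lemma drift_entry:
  assumes "a < n"
  shows "(\<Sum>b<n. B $$ (a, b)) + (\<Sum>b<n. A0 $$ (a, b)) \<le> d - (\<Sum>b<n. A2 $$ (a, b))"
proof -
  have "(\<Sum>b<n. B $$ (a, b)) = (\<Sum>b<n. A1 $$ (a, b) + (if a = b then d else 0))"
    using assms by (intro sum.cong) (auto simp: B_entry)
  also have "\<dots> = (\<Sum>b<n. A1 $$ (a, b)) + d"
    using assms by (simp add: sum.distrib)
  finally show ?thesis using row_sums[OF assms] by simp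
qed

text \<open>Sum row \<open>a\<close> of the recursion. The induction hypothesis bounds the factor
  \<open>?X * A2\<close> of the quadratic term by 1, and \<open>drift_entry\<close> then bounds
  \<open>d\<close> times the row total of \<open>?Y\<close> by 1 plus \<open>d\<close> times that of
  \<open>?X\<close>, minus the exit mass of \<open>?X\<close>.\<close>

lemma sojourn_exit: "a < n \<Longrightarrow> (\<Sum>b<n. (sojourn t * A2) $$ (a, b)) \<le> 1"
proof (induction t arbitrary: a)
  case 0
  have "0\<^sub>m n n * A2 = 0\<^sub>m n n" by (rule left_mult_zero_mat) simp
  with 0 show ?case by simp
next
  case (Suc t)
  let ?X = "sojourn t" and ?Y = "sojourn (Suc t)"
  let ?r = "\<lambda>c. \<Sum>b<n. A2 $$ (c, b)"
  have c: "?X \<in> carrier_mat n n" "?Y \<in> carrier_mat n n" by (rule sojourn_carr)+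
  note sm = row_sum_mult[where nr = n and n = n and m = n, OF _ _ Suc.prems]
  have X: "0 \<le> ?X $$ (a, c)" if "c < n" for c using sojourn_entry Suc.prems that by simp
  have XA0: "0 \<le> (?X * A0) $$ (a, c)" if "c < n" for c
    using mat_nonnegD[OF mult_mat_nonneg[OF sojourn_nonneg A0_nonneg]] Suc.prems that c(1)
    by (simp del: index_mult_mat(1))
  have "d * (\<Sum>b<n. ?Y $$ (a, b)) = (\<Sum>b<n. (d \<cdot>\<^sub>m ?Y) $$ (a, b))"
    using Suc.prems by (simp add: sum_distrib_left carrier_matD[OF sojourn_carr])
  also have "\<dots> = (\<Sum>b<n. (if a = b then 1 else 0) + (?X * B) $$ (a, b) + (?X * A0 * (?X * A2)) $$ (a, b))"
  proof (rule sum.cong)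
    fix b assume "b \<in> {..<n}"
    moreover have "?X * A0 * ?X * A2 = ?X * A0 * (?X * A2)"
      by (rule mat_assoc[where m = n and n = n]) auto
    ultimately show "(d \<cdot>\<^sub>m ?Y) $$ (a, b) =
        (if a = b then 1 else 0) + (?X * B) $$ (a, b) + (?X * A0 * (?X * A2)) $$ (a, b)"
      unfolding sojourn_Suc using Suc.prems
      by (simp del: index_mult_mat(1) add: carrier_matD[OF sojourn_carr] carrier_matD[OF B_carr] dims)
  qed simp
  also have "\<dots> = 1 + (\<Sum>b<n. (?X * B) $$ (a, b)) + (\<Sum>b<n. (?X * A0 * (?X * A2)) $$ (a, b))"
    using Suc.prems by (simp add: sum.distrib)
  also have "(\<Sum>b<n. (?X * A0 * (?X * A2)) $$ (a, b)) =
      (\<Sum>c<n. (?X * A0) $$ (a, c) * (\<Sum>b<n. (?X * A2) $$ (c, b)))"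
    by (rule sm) auto
  also have "\<dots> \<le> (\<Sum>c<n. (?X * A0) $$ (a, c) * 1)"
    by (intro sum_mono mult_left_mono) (use Suc.IH XA0 in auto)
  also have "(\<Sum>c<n. (?X * A0) $$ (a, c) * 1) = (\<Sum>c<n. ?X $$ (a, c) * (\<Sum>b<n. A0 $$ (c, b)))"
    using sm[of ?X A0] by simp
  also have "(\<Sum>b<n. (?X * B) $$ (a, b)) = (\<Sum>c<n. ?X $$ (a, c) * (\<Sum>b<n. B $$ (c, b)))"
    by (rule sm) auto
  also have "1 + (\<Sum>c<n. ?X $$ (a, c) * (\<Sum>b<n. B $$ (c, b))) + (\<Sum>c<n. ?X $$ (a, c) * (\<Sum>b<n. A0 $$ (c, b)))
      = 1 + (\<Sum>c<n. ?X $$ (a, c) * ((\<Sum>b<n. B $$ (c, b)) + (\<Sum>b<n. A0 $$ (c, b))))"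
    by (simp add: sum.distrib algebra_simps)
  also have "\<dots> \<le> 1 + (\<Sum>c<n. ?X $$ (a, c) * (d - ?r c))"
    by (intro add_left_mono sum_mono mult_left_mono) (use drift_entry X in auto)
  also have "\<dots> = 1 + d * (\<Sum>c<n. ?X $$ (a, c)) - (\<Sum>c<n. ?X $$ (a, c) * ?r c)"
    by (simp add: algebra_simps sum_subtractf sum_distrib_left)
  finally have 1: "d * (\<Sum>b<n. ?Y $$ (a, b)) \<le> \<dots>" by simp
  \<comment> \<open>The increments are nonnegative and \<open>?r c \<le> d\<close>, so the exit mass
    grows by at most \<open>d\<close> times the growth of the row total. Adding estimate
    \<open>1\<close> cancels the row totals and leaves the bound 1.\<close>
  have "(\<Sum>c<n. (?Y $$ (a, c) - ?X $$ (a, c)) * ?r c) \<le> (\<Sum>c<n. (?Y $$ (a, c) - ?X $$ (a, c)) * d)"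
    using sojourn_entry_mono[OF Suc.prems] d_bounds(3)
    by (intro sum_mono mult_left_mono) auto
  then have "(\<Sum>c<n. ?Y $$ (a, c) * ?r c) - (\<Sum>c<n. ?X $$ (a, c) * ?r c)
      \<le> d * (\<Sum>b<n. ?Y $$ (a, b)) - d * (\<Sum>c<n. ?X $$ (a, c))"
    by (simp add: algebra_simps sum_subtractf sum_distrib_left)
  with 1 have "(\<Sum>c<n. ?Y $$ (a, c) * ?r c) \<le> 1" by linarith
  then show ?case using sm[of ?Y A2] c by (simp)
qed

text \<open>Boundedness spreads backwards along the paths of \<open>drain\<close>. Where
  \<open>A2\<close> has a positive row sum, the exit bound is divided by it. If column
  \<open>b\<close> is bounded and \<open>0 < A1 $$ (a', b)\<close>, then
  \<open>X $$ (a, a') * A1 $$ (a', b)\<close> is one term of \<open>X * B\<close>, hence at most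
  \<open>d\<close> times the next iterate in column \<open>b\<close>.\<close>

lemma sojourn_bounded:
  assumes "b < n"
  shows "\<exists>K. \<forall>t. \<forall>a<n. sojourn t $$ (a, b) \<le> K"
proof (rule drain[where C = "\<lambda>b. \<exists>K. \<forall>t. \<forall>a<n. sojourn t $$ (a, b) \<le> K", OF _ _ assms])
  fix b assume b: "b < n" and pos: "0 < (\<Sum>j<n. A2 $$ (b, j))"
  have "sojourn t $$ (a, b) \<le> 1 / (\<Sum>j<n. A2 $$ (b, j))" if a: "a < n" for t a
  proof -
    have "sojourn t $$ (a, b) * (\<Sum>j<n. A2 $$ (b, j))
        \<le> (\<Sum>c<n. sojourn t $$ (a, c) * (\<Sum>j<n. A2 $$ (c, j)))"
      using member_le_sum[of b "{..<n}" "\<lambda>c. sojourn t $$ (a, c) * (\<Sum>j<n. A2 $$ (c, j))"]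
      using b a sojourn_entry A2_row_nonneg by simp
    also have "\<dots> \<le> 1" using sojourn_exit[OF a, of t] row_sum_mult[of "sojourn t" n n A2 n a] a by simp
    finally show ?thesis using pos by (simp add: field_simps)
  qed
  then show "\<exists>K. \<forall>t. \<forall>a<n. sojourn t $$ (a, b) \<le> K" by blast
next
  fix a' b assume ab: "a' < n" "b < n" "a' \<noteq> b" and pos: "0 < A1 $$ (a', b)"
    and "\<exists>K. \<forall>t. \<forall>a<n. sojourn t $$ (a, b) \<le> K"
  then obtain K where K: "\<And>t a. a < n \<Longrightarrow> sojourn t $$ (a, b) \<le> K" by blast
  have "sojourn t $$ (a, a') \<le> d * K / A1 $$ (a', b)" if a: "a < n" for t a
  proof -
    let ?X = "sojourn t"
    have "?X $$ (a, a') * A1 $$ (a', b) = ?X $$ (a, a') * B $$ (a', b)" using ab by (simp add: B_entry)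
    also have "\<dots> \<le> (\<Sum>c<n. ?X $$ (a, c) * B $$ (c, b))"
      using member_le_sum[of a' "{..<n}" "\<lambda>c. ?X $$ (a, c) * B $$ (c, b)"]
        ab a sojourn_entry mat_nonnegD[OF B_nonneg B_carr] by simp
    also have "\<dots> = (?X * B) $$ (a, b)"
      by (rule mult_mat_entry[symmetric, of _ n _ _ n]) (use a ab in auto)
    also have "\<dots> \<le> (1\<^sub>m n + ?X * B + ?X * A0 * ?X * A2) $$ (a, b)"
    proof -
      have "0\<^sub>m n n \<le> ?X * A0 * ?X * A2"
        by (intro mult_mat_nonneg[where nr = n and n = n and nc = n] sojourn_nonneg A0_nonneg A2_nonneg
            mult_carrier_mat[where n = n] carr sojourn_carr)
      moreover have "?X * A0 * ?X * A2 \<in> carrier_mat n n"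
        by (intro mult_carrier_mat[where n = n] carr sojourn_carr)
      ultimately have "0 \<le> (?X * A0 * ?X * A2) $$ (a, b)" using a ab by (intro mat_nonnegD)
      then show ?thesis using a ab
        by (simp del: index_mult_mat(1) add: carrier_matD[OF sojourn_carr] carrier_matD[OF B_carr] dims)
    qed
    also have "\<dots> = d * sojourn (Suc t) $$ (a, b)"
      unfolding sojourn_Suc[symmetric] using a ab by (simp add: carrier_matD[OF sojourn_carr])
    also have "\<dots> \<le> d * K" using K[OF a] d_bounds(1) by (intro mult_left_mono) auto
    finally show ?thesis using pos by (simp add: field_simps)
  qed
  then show "\<exists>K. \<forall>t. \<forall>a<n. sojourn t $$ (a, a') \<le> K" by blast
qed

section \<open>The limit of the iteration\<close>

definition N :: "real mat" where
  "N = mat n n (\<lambda>(a, b). lim (\<lambda>t. sojourn t $$ (a, b)))"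

lemma N_carr [simp]: "N \<in> carrier_mat n n" by (simp add: N_def)

lemma sojourn_tendsto: "mat_tendsto n n sojourn N"
  unfolding mat_tendsto_def
proof (intro conjI allI impI)
  fix a b assume ab: "a < n" "b < n"
  obtain K where K: "\<And>t a. a < n \<Longrightarrow> sojourn t $$ (a, b) \<le> K" using sojourn_bounded[OF ab(2)] by blast
  have "incseq (\<lambda>t. sojourn t $$ (a, b))"
    by (intro incseq_SucI sojourn_entry_mono ab)
  with K[OF ab(1)] have "convergent (\<lambda>t. sojourn t $$ (a, b))"
    by (metis incseq_convergent convergent_def)
  then show "(\<lambda>t. sojourn t $$ (a, b)) \<longlonglongrightarrow> N $$ (a, b)"
    using ab by (simp add: N_def convergent_LIMSEQ_iff)
qed auto

lemma N_nonneg: "0\<^sub>m n n \<le> N"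
  by (rule mat_tendsto_ge[OF sojourn_tendsto sojourn_nonneg]) auto

lemma N_fixpoint: "d \<cdot>\<^sub>m N = 1\<^sub>m n + N * B + N * A0 * N * A2"
proof (rule mat_tendsto_unique)
  show "mat_tendsto n n (\<lambda>t. d \<cdot>\<^sub>m sojourn (Suc t)) (d \<cdot>\<^sub>m N)"
    by (intro mat_tendsto_smult mat_tendsto_Suc sojourn_tendsto)
  show "mat_tendsto n n (\<lambda>t. d \<cdot>\<^sub>m sojourn (Suc t)) (1\<^sub>m n + N * B + N * A0 * N * A2)"
    unfolding sojourn_Suc
    by (intro mat_tendsto_add mat_tendsto_mult[where n = n] mat_tendsto_const sojourn_tendsto) auto
qed

text \<open>Expanding \<open>B = A1 + d I\<close> in the fixed-point equation makes the terms
  \<open>d N\<close> cancel.\<close>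

lemma N_inverse: "N * (- (A1 + A0 * N * A2)) = 1\<^sub>m n"
proof -
  have "N * B = N * A1 + d \<cdot>\<^sub>m N"
    unfolding B_def
    by (simp add: mult_add_distrib_mat[of _ n n _ n] mult_smult_distrib[where nr = n and n = n and nc = n]
        right_mult_one_mat[of N n n])
  then have *: "d \<cdot>\<^sub>m N = 1\<^sub>m n + (N * A1 + d \<cdot>\<^sub>m N) + N * A0 * N * A2"
    using N_fixpoint by simp
  have "N * (- (A1 + A0 * N * A2)) = - (N * A1 + N * A0 * N * A2)"
    by (simp add: mat_distrib[where m = n and n = n] carrier_matD[OF N_carr]
        dims
        mat_assoc[where m = n and n = n])
  also have "\<dots> = 1\<^sub>m n"
  proof (rule eq_matI)
    fix i j assume ij: "i < dim_row (1\<^sub>m n :: real mat)" "j < dim_col (1\<^sub>m n :: real mat)"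
    have "(d \<cdot>\<^sub>m N) $$ (i, j) = (1\<^sub>m n + (N * A1 + d \<cdot>\<^sub>m N) + N * A0 * N * A2) $$ (i, j)"
      using * by simp
    then show "(- (N * A1 + N * A0 * N * A2)) $$ (i, j) = (1\<^sub>m n :: real mat) $$ (i, j)"
      using ij by (simp add: carrier_matD[OF N_carr] dims del: index_mult_mat(1))
  qed (auto simp: carrier_matD[OF N_carr] dims)
  finally show ?thesis .
qed

lemma N_exit:
  assumes "a < n"
  shows "(\<Sum>b<n. (N * A2) $$ (a, b)) \<le> 1"
proof (rule LIMSEQ_le_const2)
  have "mat_tendsto n n (\<lambda>t. sojourn t * A2) (N * A2)"
    by (intro mat_tendsto_mult[where n = n] mat_tendsto_const sojourn_tendsto) auto
  then show "(\<lambda>t. \<Sum>b<n. (sojourn t * A2) $$ (a, b)) \<longlonglongrightarrow> (\<Sum>b<n. (N * A2) $$ (a, b))"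
    using assms by (intro tendsto_sum) (auto simp: mat_tendsto_def)
qed (use sojourn_exit assms in auto)

section \<open>Comparison with solutions of the balance and quadratic equations\<close>

text \<open>In uniformized form the balance equation expresses \<open>d \<Psi> (k+1)\<close> as
  \<open>\<Psi> k A0 + \<Psi> (k+1) B + \<Psi> (k+2) A2\<close>; the recursion for
  \<open>\<Psi> k * (A0 * sojourn t)\<close> has the same shape with smaller terms. The number
  \<open>m\<close> of rows is free: one row serves the stationary vector, \<open>n\<close> rows
  serve the powers of a solution matrix.\<close>

lemma sequence_lower_bound:
  assumes c: "\<And>k. \<Psi> k \<in> carrier_mat m n" and nonneg: "\<And>k. 0\<^sub>m m n \<le> \<Psi> k"
    and balance: "\<And>k. \<Psi> k * A0 + \<Psi> (Suc k) * A1 + \<Psi> (Suc (Suc k)) * A2 = 0\<^sub>m m n"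
  shows "\<Psi> k * (A0 * N) \<le> \<Psi> (Suc k)"
proof (rule mat_tendsto_le)
  show "mat_tendsto m n (\<lambda>t. \<Psi> k * (A0 * sojourn t)) (\<Psi> k * (A0 * N))"
    by (intro mat_tendsto_mult[where n = n] mat_tendsto_const sojourn_tendsto c) auto
  show "\<Psi> k * (A0 * sojourn t) \<le> \<Psi> (Suc k)" for t
  proof (induction t arbitrary: k)
    case 0
    have "\<Psi> k * (A0 * 0\<^sub>m n n) = 0\<^sub>m m n"
      using c[of k] by (simp add: right_mult_zero_mat[where n = n and nr = n]
          right_mult_zero_mat[where n = n and nr = m])
    then show ?case using nonneg by simp
  next
    case (Suc t)
    let ?X = "sojourn t"
    let ?R = "A0 * ?X"
    have X: "?X \<in> carrier_mat n n" by (rule sojourn_carr)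
    have R: "0\<^sub>m n n \<le> ?R" by (intro mult_mat_nonneg[where n = n] A0_nonneg sojourn_nonneg) auto
    have 0: "0\<^sub>m m n \<le> \<Psi> k * ?R" for k by (rule mult_mat_nonneg[where n = n]) (use R c nonneg in auto)
    have 00: "0\<^sub>m m n \<le> \<Psi> k * ?R * ?R" for k by (rule mult_mat_nonneg[where n = n]) (use 0 R c in auto)
    have 1: "\<Psi> k * ?R * B \<le> \<Psi> (Suc k) * B" for k
      by (rule mult_mat_mono[where n = n and nr = m and nc = n]) (use Suc 0 B_nonneg c in auto)
    \<comment> \<open>The induction hypothesis is used at \<open>k\<close> and then at
      \<open>Suc k\<close>; this is why the induction keeps \<open>k\<close> arbitrary.\<close>
    have "\<Psi> k * ?R * ?R \<le> \<Psi> (Suc k) * ?R"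
      by (rule mult_mat_mono[where n = n and nr = m and nc = n]) (use Suc 0 R c in auto)
    also have "\<dots> \<le> \<Psi> (Suc (Suc k))" by (rule Suc)
    finally have 2: "\<Psi> k * ?R * ?R * A2 \<le> \<Psi> (Suc (Suc k)) * A2"
      by (rule mult_mat_mono[where n = n and nr = m and nc = n])
         (use 00 c[of k] c[of "Suc (Suc k)"] A2_nonneg in auto)
    have "d \<cdot>\<^sub>m (\<Psi> k * (A0 * sojourn (Suc t))) = \<Psi> k * (A0 * (d \<cdot>\<^sub>m sojourn (Suc t)))"
      using c[of k] sojourn_carr[of "Suc t"]
      by (simp add: mult_smult_distrib[where nr = n and n = n and nc = n]
          mult_smult_distrib[where nr = m and n = n and nc = n])
    also have "\<dots> = \<Psi> k * A0 + \<Psi> k * ?R * B + \<Psi> k * ?R * ?R * A2"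
    proof -
      have "A0 * (1\<^sub>m n + ?X * B + ?X * A0 * ?X * A2) = A0 + ?R * B + ?R * ?R * A2"
        using X by (simp add: mat_distrib[where m = n and n = n] mat_assoc[where m = n and n = n]
            right_mult_one_mat[of A0 n n])
      moreover have "\<Psi> k * (A0 + ?R * B + ?R * ?R * A2) = \<Psi> k * A0 + \<Psi> k * ?R * B + \<Psi> k * ?R * ?R * A2"
        using X c[of k] by (simp add: mat_distrib[where m = m and n = n] mat_assoc[where m = m and n = n])
      ultimately show ?thesis unfolding sojourn_Suc by simp
    qed
    also have "\<dots> \<le> \<Psi> k * A0 + \<Psi> (Suc k) * B + \<Psi> (Suc (Suc k)) * A2"
      by (intro add_mat_mono[where nr = m and nc = n] 1 2 order_refl) (use c in auto)
    also have "\<dots> = d \<cdot>\<^sub>m \<Psi> (Suc k)"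
    proof -
      have "\<Psi> (Suc k) * B = \<Psi> (Suc k) * A1 + d \<cdot>\<^sub>m \<Psi> (Suc k)"
        unfolding B_def using c[of "Suc k"]
        by (simp add: mat_distrib[where m = m and n = n] mult_smult_distrib[where nr = m and n = n and nc = n])
      then have "\<Psi> k * A0 + \<Psi> (Suc k) * B + \<Psi> (Suc (Suc k)) * A2 =
         (\<Psi> k * A0 + \<Psi> (Suc k) * A1 + \<Psi> (Suc (Suc k)) * A2) + d \<cdot>\<^sub>m \<Psi> (Suc k)"
        using c[of k] c[of "Suc k"] c[of "Suc (Suc k)"]
          dims
        by (intro eq_matI) (auto simp del: index_mult_mat(1))
      then show ?thesis unfolding balance using c[of "Suc k"] by simp
    qed
    finally have *: "d \<cdot>\<^sub>m (\<Psi> k * (A0 * sojourn (Suc t))) \<le> d \<cdot>\<^sub>m \<Psi> (Suc k)" .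
    have c': "\<Psi> k * (A0 * sojourn (Suc t)) \<in> carrier_mat m n"
      by (intro mult_carrier_mat[where n = n]) (use c in auto)
    show ?case
    proof (rule mat_leI)
      fix i j assume ij: "i < m" "j < n"
      show "(\<Psi> k * (A0 * sojourn (Suc t))) $$ (i, j) \<le> \<Psi> (Suc k) $$ (i, j)"
        using mat_leD[OF * _ ij] ij carrier_matD[OF c'] c[of "Suc k"] d_bounds(1)
        by (simp del: index_mult_mat)
    qed (use c c' in auto)
  qed
qed (use c in auto)


lemma N_inverse_right: "- (A1 + A0 * N * A2) * N = 1\<^sub>m n"
  by (rule mat_mult_left_right_inverse[OF _ _ N_inverse]) auto

lemma sequence_recursion:
  assumes c: "\<And>k. \<Psi> k \<in> carrier_mat 1 n" and nonneg: "\<And>k. 0\<^sub>m 1 n \<le> \<Psi> k"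
    and balance: "\<And>k. \<Psi> k * A0 + \<Psi> (Suc k) * A1 + \<Psi> (Suc (Suc k)) * A2 = 0\<^sub>m 1 n"
    and vanish: "\<And>j. j < n \<Longrightarrow> (\<lambda>k. \<Psi> k $$ (0, j)) \<longlonglongrightarrow> 0"
  shows "\<Psi> (Suc k) = \<Psi> k * (A0 * N)"
proof -
  define R where "R = A0 * N"
  define U where "U = - (A1 + R * A2)"
  define D where "D k = \<Psi> (Suc k) - \<Psi> k * R" for k
  have R: "R \<in> carrier_mat n n" by (simp add: R_def)
  have U: "U \<in> carrier_mat n n" by (simp add: U_def R)
  have NU: "N * U = 1\<^sub>m n" "U * N = 1\<^sub>m n"
    using N_inverse N_inverse_right by (simp_all add: U_def R_def)
  have R0: "0\<^sub>m n n \<le> R"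
    unfolding R_def by (intro mult_mat_nonneg[where n = n] A0_nonneg N_nonneg) auto
  have Dc: "D k \<in> carrier_mat 1 n" for k
    unfolding D_def by (intro minus_carrier_mat mult_carr[OF c R])
  have De: "D k $$ (0, j) = \<Psi> (Suc k) $$ (0, j) - (\<Psi> k * R) $$ (0, j)" if "j < n" for k j
    using that carrier_matD[OF c[of k]] carrier_matD[OF R] by (simp add: D_def del: index_mult_mat(1))
  have D0: "0\<^sub>m 1 n \<le> D k" for k
  proof (rule mat_leI)
    fix i j assume ij: "i < (1::nat)" "j < n"
    have "(\<Psi> k * R) $$ (0, j) \<le> \<Psi> (Suc k) $$ (0, j)"
      using mat_leD[OF sequence_lower_bound[of \<Psi> 1 k, OF c nonneg balance] c, of 0 j] ij
      unfolding R_def by simp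
    then show "(0\<^sub>m 1 n :: real mat) $$ (i, j) \<le> D k $$ (i, j)" using ij De by simp
  qed (use Dc in auto)
  \<comment> \<open>As \<open>R * U = A0\<close>, the left side is
    \<open>\<Psi> (Suc k) * U - \<Psi> k * A0\<close>; the balance equation trades its
    \<open>A0\<close> and \<open>A1\<close> terms for the \<open>A2\<close> term of the next
    level.\<close>
  have DU: "D k * U = D (Suc k) * A2" for k
  proof -
    have RU: "R * U = A0" unfolding R_def using NU U
      by (simp add: mat_assoc[where m = n and n = n] right_mult_one_mat[of A0 n n])
    have 1: "D k * U = \<Psi> (Suc k) * U - \<Psi> k * A0"
      unfolding D_def using c[of "Suc k"] c[of k] R U RU
      by (simp add: minus_mult_distrib_mat[where nr = 1 and n = n and nc = n]
          mat_assoc[where m = 1 and n = n])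
    have 2: "\<Psi> (Suc k) * U = - (\<Psi> (Suc k) * A1 + \<Psi> (Suc k) * R * A2)"
      unfolding U_def using c[of "Suc k"] R
      by (simp add: mat_distrib[where m = 1 and n = n]
          mat_assoc[where m = 1 and n = n] carrier_matD[OF R] dims)
    have 3: "D (Suc k) * A2 = \<Psi> (Suc (Suc k)) * A2 - \<Psi> (Suc k) * R * A2"
      unfolding D_def using c[of "Suc k"] c[of "Suc (Suc k)"] R
      by (simp add: minus_mult_distrib_mat[where nr = 1 and n = n and nc = n])
    show ?thesis
    proof (rule eq_matI)
      fix i j assume "i < dim_row (D (Suc k) * A2)" "j < dim_col (D (Suc k) * A2)"
      then have ij: "i = 0" "j < n" using carrier_matD[OF Dc[of "Suc k"]] dims by auto
      have "(\<Psi> k * A0 + \<Psi> (Suc k) * A1 + \<Psi> (Suc (Suc k)) * A2) $$ (0, j) = 0"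
        unfolding balance using ij by simp
      then show "(D k * U) $$ (i, j) = (D (Suc k) * A2) $$ (i, j)"
        unfolding 1 2 3 using ij carrier_matD[OF c[of k]] carrier_matD[OF c[of "Suc k"]] carrier_matD[OF c[of "Suc (Suc k)"]]
          carrier_matD[OF R] dims
        by (simp del: index_mult_mat(1))
    qed (use carrier_matD[OF Dc] carrier_matD[OF U] dims in auto)
  qed
  have DN: "D k = D (Suc k) * A2 * N" for k
  proof -
    have "D k = D k * (U * N)" using Dc[of k] by (simp add: NU right_mult_one_mat[where nr = 1 and nc = n])
    also have "\<dots> = D k * U * N"
      by (rule mat_assoc[where m = 1 and n = n, symmetric]) (use Dc U in auto)
    finally show ?thesis unfolding DU .
  qed
  define \<delta> where "\<delta> k = (\<Sum>j<n. (D k * A2) $$ (0, j))" for k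
  have DA0: "0 \<le> (D k * A2) $$ (0, j)" if "j < n" for k j
    by (rule mat_nonnegD[OF mult_mat_nonneg[OF D0 A2_nonneg]]) (use Dc that in auto)
  \<comment> \<open>\<open>D k * A2\<close> arises from \<open>D (Suc k) * A2\<close> by
    multiplication with the substochastic matrix \<open>N * A2\<close>, so mass can only be lost on
    the way down.\<close>
  have "\<delta> k \<le> \<delta> (Suc k)" for k
  proof -
    have "D k * A2 = D (Suc k) * A2 * (N * A2)"
      by (subst DN, rule mat_assoc[where m = 1 and n = n]) (use Dc in auto)
    then have "\<delta> k = (\<Sum>c<n. (D (Suc k) * A2) $$ (0, c) * (\<Sum>b<n. (N * A2) $$ (c, b)))"
      unfolding \<delta>_def by (simp only:, intro row_sum_mult[where nr = 1]) (use Dc in auto)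
    also have "\<dots> \<le> (\<Sum>c<n. (D (Suc k) * A2) $$ (0, c) * 1)"
      by (intro sum_mono mult_left_mono) (use N_exit DA0 in auto)
    finally show ?thesis by (simp add: \<delta>_def)
  qed
  then have inc: "incseq \<delta>" by (rule incseq_SucI)
  \<comment> \<open>\<open>D k\<close> is squeezed between 0 and
    \<open>\<Psi> (Suc k)\<close>.\<close>
  have D_lim: "(\<lambda>k. D k $$ (0, j)) \<longlonglongrightarrow> 0" if j: "j < n" for j
  proof (rule tendsto_sandwich)
    show "\<forall>\<^sub>F k in sequentially. 0 \<le> D k $$ (0, j)"
      using mat_nonnegD[OF D0 Dc] j by simp
    have "0 \<le> (\<Psi> k * R) $$ (0, j)" for k
      by (rule mat_nonnegD[OF mult_mat_nonneg[OF nonneg R0]]) (use c R j in auto)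
    then show "\<forall>\<^sub>F k in sequentially. D k $$ (0, j) \<le> \<Psi> (Suc k) $$ (0, j)"
      using De[OF j] by simp
    show "(\<lambda>k. \<Psi> (Suc k) $$ (0, j)) \<longlonglongrightarrow> 0" by (rule LIMSEQ_Suc[OF vanish[OF j]])
  qed auto
  have "\<delta> \<longlonglongrightarrow> 0"
  proof -
    have "\<delta> = (\<lambda>k. \<Sum>c<n. D k $$ (0, c) * (\<Sum>j<n. A2 $$ (c, j)))"
      unfolding \<delta>_def by (intro ext row_sum_mult[where nr = 1]) (use Dc in auto)
    also have "\<dots> \<longlonglongrightarrow> (\<Sum>c<n. 0 * (\<Sum>j<n. A2 $$ (c, j)))"
      by (intro tendsto_sum tendsto_mult tendsto_const D_lim) auto
    finally show ?thesis by simp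
  qed
  \<comment> \<open>A nondecreasing sequence lies below its limit. With nonnegativity this forces
    \<open>D k * A2 = 0\<close> for all \<open>k\<close>, and \<open>DN\<close> then gives
    \<open>D k = 0\<close>.\<close>
  then have le: "\<delta> k \<le> 0" for k by (rule incseq_le[OF inc])
  have DA: "D k * A2 = 0\<^sub>m 1 n" for k
  proof (rule eq_matI)
    fix i j assume ij: "i < dim_row (0\<^sub>m 1 n :: real mat)" "j < dim_col (0\<^sub>m 1 n :: real mat)"
    have "(D k * A2) $$ (0, j) \<le> \<delta> k"
      unfolding \<delta>_def using member_le_sum[of j "{..<n}" "\<lambda>j. (D k * A2) $$ (0, j)"] ij DA0 by simp
    with le[of k] DA0[of j k] ij show "(D k * A2) $$ (i, j) = (0\<^sub>m 1 n :: real mat) $$ (i, j)" by simp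
  qed (use carrier_matD[OF Dc[of k]] dims in auto)
  have "D k = 0\<^sub>m 1 n" for k
    by (subst DN) (simp add: DA left_mult_zero_mat[where n = n and nc = n])
  then have "D k $$ (0, j) = 0" if "j < n" for j using that by simp
  then show ?thesis
    unfolding R_def[symmetric]
    by (intro eq_matI) (use De[of _ k] carrier_matD[OF c[of k]] carrier_matD[OF c[of "Suc k"]] carrier_matD[OF R]
       in \<open>auto simp del: index_mult_mat(1)\<close>)
qed

text \<open>Multiplying the quadratic equation by a power of \<open>X\<close> from the left shows
  that the powers of \<open>X\<close> satisfy the balance equations; the comparison at exponent 0 is
  the claim.\<close>

lemma minimal_solution:
  assumes "X \<in> carrier_mat n n" "0\<^sub>m n n \<le> X" "X * X * A2 + X * A1 + A0 = 0\<^sub>m n n"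
  shows "A0 * N \<le> X"
proof -
  note X = assms(1)
  have nn: "0\<^sub>m n n \<le> X ^\<^sub>m k" for k
  proof (induction k)
    case 0
    then show ?case by (intro mat_leI[where nr = n and nc = n]) (use X in auto)
  next
    case (Suc k)
    then show ?case using X assms(2) by (simp add: mult_mat_nonneg[where n = n])
  qed
  have "X ^\<^sub>m 0 * (A0 * N) \<le> X ^\<^sub>m Suc 0"
  proof (rule sequence_lower_bound)
    fix k
    let ?Y = "X ^\<^sub>m k"
    have Y: "?Y \<in> carrier_mat n n" using X by simp
    have "?Y * A0 + ?Y * X * A1 + ?Y * X * X * A2 = ?Y * X * X * A2 + ?Y * X * A1 + ?Y * A0"
      using carrier_matD[OF X] dims
      by (intro eq_matI) (auto simp del: index_mult_mat(1))
    also have "\<dots> = ?Y * (X * X * A2 + X * A1 + A0)"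
      using X Y by (simp add: mat_distrib[where m = n and n = n]
         mat_assoc[where m = n and n = n])
    also have "\<dots> = 0\<^sub>m n n" unfolding assms(3) using Y by (simp add: right_mult_zero_mat[where nr = n and n = n])
    finally show "?Y * A0 + X ^\<^sub>m Suc k * A1 + X ^\<^sub>m Suc (Suc k) * A2 = 0\<^sub>m n n" by simp
  qed (use X nn in auto)
  then show ?thesis using X by (simp add: left_mult_one_mat[where nr = n and nc = n])
qed

text \<open>With \<open>R = A0 * N\<close>, left multiplication of \<open>N_inverse\<close> by
  \<open>A0\<close> gives \<open>A0 = - (R * A1 + R * R * A2)\<close>.\<close>

lemma solution:
  "A0 * N * (A0 * N) * A2 + A0 * N * A1 + A0 = 0\<^sub>m n n"
proof -
  define R where "R = A0 * N"
  have R: "R \<in> carrier_mat n n" by (simp add: R_def)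
  have "R * (- (A1 + R * A2)) = A0 * (N * (- (A1 + R * A2)))"
    unfolding R_def by (rule mat_assoc[where m = n and n = n]) auto
  also have "\<dots> = A0" unfolding R_def N_inverse by (simp add: right_mult_one_mat[where nr = n and nc = n])
  finally have A0: "A0 = - (R * A1 + R * R * A2)"
    using R by (simp add: mat_distrib[where m = n and n = n] carrier_matD[OF R]
         dims mat_assoc[where m = n and n = n])
  have "R * R * A2 + R * A1 + - (R * A1 + R * R * A2) = 0\<^sub>m n n"
    using carrier_matD[OF R] dims
    by (intro eq_matI) (auto simp del: index_mult_mat(1))
  then show ?thesis by (simp only: A0[symmetric] R_def[symmetric])
qed

end

section \<open>Inverses and left null vectors\<close>

text \<open>A left inverse of a square matrix is two-sided, so \<open>A\<close> is a unit and
  \<open>mat_inverse\<close> returns some matrix; uniqueness of inverses identifies it with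
  \<open>X\<close>.\<close>

lemma minv_left_inverse:
  assumes "A \<in> carrier_mat n n" "X \<in> carrier_mat n n" "X * A = 1\<^sub>m n"
  shows "minv A = X" "invertible_mat A"
proof -
  have AX: "A * X = 1\<^sub>m n" by (rule mat_mult_left_right_inverse[OF assms(2,1,3)])
  with assms show "invertible_mat A"
    unfolding invertible_mat_def inverts_mat_def by (auto intro!: exI[of _ X])
  have "A \<in> Units (ring_mat TYPE(real) n ())"
    using assms AX by (auto simp: Units_def ring_mat_simps)
  then obtain Y where Y: "mat_inverse A = Some Y"
    using mat_inverse(1)[OF assms(1), of "()"] by (cases "mat_inverse A") auto
  from mat_inverse(2)[OF assms(1) this] have Y': "A * Y = 1\<^sub>m n" "Y \<in> carrier_mat n n" by auto
  have "Y = X * A * Y" using Y' assms(3) by (simp add: left_mult_one_mat[where nr = n and nc = n])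
  also have "\<dots> = X * (A * Y)" by (rule assoc_mult_mat[OF assms(2,1) Y'(2)])
  also have "\<dots> = X" using Y' assms(2) by (simp add: right_mult_one_mat[where nr = n and nc = n])
  finally show "minv A = X" by (simp add: minv_def Y)
qed

text \<open>The entries of \<open>v\<close> may have any sign, so one passes to their absolute
  values \<open>w\<close>. Column \<open>b\<close> of \<open>v * U = 0\<close> bounds
  \<open>w b * \<bar>U $$ (b, b)\<bar>\<close> by the off-diagonal part, whence
  \<open>w U \<ge> 0\<close>; nonpositive row sums make the total nonpositive, so
  \<open>w U = 0\<close>. If \<open>w b = 0\<close>, the other terms of column \<open>b\<close> are
  nonnegative with sum 0, so zeros spread backwards along positive entries.\<close>

lemma left_null_vector_eq_0:
  fixes U v :: "real mat"
  assumes U: "U \<in> carrier_mat n n" and v: "v \<in> carrier_mat 1 n" and "v * U = 0\<^sub>m 1 n"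
    and offdiag: "\<And>i j. i < n \<Longrightarrow> j < n \<Longrightarrow> i \<noteq> j \<Longrightarrow> 0 \<le> U $$ (i, j)"
    and row_sums: "\<And>i. i < n \<Longrightarrow> (\<Sum>j<n. U $$ (i, j)) \<le> 0"
    and reach: "\<And>C a. C r \<Longrightarrow>
      (\<And>a b. a < n \<Longrightarrow> b < n \<Longrightarrow> a \<noteq> b \<Longrightarrow> 0 < U $$ (a, b) \<Longrightarrow> C b \<Longrightarrow> C a) \<Longrightarrow> a < n \<Longrightarrow> C a"
    and "v $$ (0, r) = 0"
  shows "v = 0\<^sub>m 1 n"
proof -
  define w where "w a = \<bar>v $$ (0, a)\<bar>" for a
  have split: "(\<Sum>a<n. f a) = f b + (\<Sum>a\<in>{..<n} - {b}. f a)" if "b < n" for b and f :: "nat \<Rightarrow> real"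
    using that by (intro sum.remove) auto
  have ge: "0 \<le> (\<Sum>a<n. w a * U $$ (a, b))" if b: "b < n" for b
  proof -
    have "(\<Sum>a<n. v $$ (0, a) * U $$ (a, b)) = 0"
      using mult_mat_entry[OF v U, of 0 b] assms(3) b by simp
    then have "\<bar>v $$ (0, b) * U $$ (b, b)\<bar> = \<bar>\<Sum>a\<in>{..<n} - {b}. v $$ (0, a) * U $$ (a, b)\<bar>"
      using split[OF b, of "\<lambda>a. v $$ (0, a) * U $$ (a, b)"] by linarith
    also have "\<dots> \<le> (\<Sum>a\<in>{..<n} - {b}. \<bar>v $$ (0, a) * U $$ (a, b)\<bar>)" by (rule sum_abs)
    also have "\<dots> = (\<Sum>a\<in>{..<n} - {b}. w a * U $$ (a, b))"
      using offdiag b by (intro sum.cong) (auto simp: w_def abs_mult)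
    finally have "w b * \<bar>U $$ (b, b)\<bar> \<le> (\<Sum>a\<in>{..<n} - {b}. w a * U $$ (a, b))"
      by (simp add: w_def abs_mult)
    moreover have "- (w b * \<bar>U $$ (b, b)\<bar>) \<le> w b * U $$ (b, b)"
      using mult_left_mono[of "- \<bar>U $$ (b, b)\<bar>" "U $$ (b, b)" "w b"] by (simp add: w_def)
    ultimately show ?thesis using split[OF b, of "\<lambda>a. w a * U $$ (a, b)"] by linarith
  qed
  have "(\<Sum>b<n. \<Sum>a<n. w a * U $$ (a, b)) = (\<Sum>a<n. w a * (\<Sum>b<n. U $$ (a, b)))"
    by (subst sum.swap) (simp add: sum_distrib_left)
  also have "\<dots> \<le> 0"
  proof (rule sum_nonpos)
    show "w a * (\<Sum>b<n. U $$ (a, b)) \<le> 0" if "a \<in> {..<n}" for a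
      using that row_sums by (intro mult_nonneg_nonpos) (auto simp: w_def)
  qed
  finally have "(\<Sum>b<n. \<Sum>a<n. w a * U $$ (a, b)) = 0"
    using sum_nonneg[of "{..<n}" "\<lambda>b. \<Sum>a<n. w a * U $$ (a, b)"] ge by force
  then have null: "(\<Sum>a<n. w a * U $$ (a, b)) = 0" if "b < n" for b
    using ge that by (subst (asm) sum_nonneg_eq_0_iff) auto
  have "w a = 0" if "a < n" for a
  proof (rule reach[where C = "\<lambda>a. w a = 0", OF _ _ that])
    show "w r = 0" using assms by (simp add: w_def)
    fix a b assume ab: "a < n" "b < n" "a \<noteq> b" "0 < U $$ (a, b)" "w b = 0"
    have "(\<Sum>a\<in>{..<n} - {b}. w a * U $$ (a, b)) = 0"
      using null[OF ab(2)] split[OF ab(2), of "\<lambda>a. w a * U $$ (a, b)"] ab(5) by simp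
    then have "\<forall>a\<in>{..<n} - {b}. w a * U $$ (a, b) = 0"
      using offdiag ab(2) by (subst (asm) sum_nonneg_eq_0_iff) (auto simp: w_def)
    then show "w a = 0" using ab by auto
  qed
  then show ?thesis using v by (intro eq_matI) (auto simp: w_def)
qed

subsection \<open>The queueing-inventory process\<close>

lemma rate_nonneg:
  assumes "admissible P"
  shows "0 \<le> rate P x y"
proof -
  obtain k i n m where "x = (k, i, n, m)" by (metis prod_cases4)
  with assms show ?thesis
    unfolding admissible_def by (auto simp: rate.simps intro!: add_nonneg_nonneg)
qed

lemma rate_pos:
  assumes "admissible P"
  shows rate_arrival: "m < hall_size P \<Longrightarrow> 0 < rate P (k, i, n, m) (k, i, n, m + 1)"
    and rate_retrial: "1 \<le> k \<Longrightarrow> m < hall_size P \<Longrightarrow> 0 < rate P (k, i, n, m) (k - 1, i, n, m + 1)"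
    and rate_service: "1 \<le> n \<Longrightarrow> 1 \<le> i \<Longrightarrow> 1 \<le> m \<Longrightarrow> 0 < rate P (k, i, n, m)
      (k, i - 1, (if n \<le> max (i - 1) (m - 1) then n else n - 1), m - 1)"
    and rate_replenishment: "i \<le> reorder_lvl P \<Longrightarrow> 0 < rate P (k, i, n, m) (k, i + order_qty P, n, m)"
    and rate_vacation: "n < num_servers P \<Longrightarrow> n + 1 \<le> max i m \<Longrightarrow>
      0 < rate P (k, i, n, m) (k, i, n + 1, m)"
  using assms unfolding admissible_def
  by (auto simp: rate.simps busy_def intro!: add_pos_nonneg add_nonneg_pos add_nonneg_nonneg)

text \<open>The phase \<open>(0, 0, 0)\<close> is reached without changing the orbit level.
  Customers are served one by one, after a replenishment if there is no stock and after waking a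
  server if all are on vacation. Once the hall is empty, each remaining item is used up by one
  arrival and its service.\<close>

lemma phase_reachability_induct [consumes 2, case_names base step]:
  assumes adm: "admissible P" and "x \<in> phase_set P"
    and base: "Q (0, 0, 0)"
    and step: "\<And>x y. x \<in> phase_set P \<Longrightarrow> y \<in> phase_set P \<Longrightarrow> x \<noteq> y \<Longrightarrow>
      0 < rate P (k, x) (k, y) \<Longrightarrow> Q y \<Longrightarrow> Q x"
  shows "Q x"
proof -
  \<comment> \<open>A positive rate already puts \<open>y\<close> into the phase set and makes it
    differ from \<open>x\<close>.\<close>
  have step': "Q x" if "0 < rate P (k, x) (k, y)" "x \<in> phase_set P" "y \<in> phase_set P \<Longrightarrow> Q y" for x y
    using step[of x y] rate_target[OF adm that(2), of k k y] that by auto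
  have c: "0 < num_servers P" "num_servers P \<le> hall_size P"
      "num_servers P \<le> reorder_lvl P" "reorder_lvl P < order_qty P"
    using adm by (auto simp: admissible_def)
  \<comment> \<open>The new server count \<open>n'\<close> is left open, since a completion may send
    a server on vacation.\<close>
  have serve: "Q (i, n, m)" if "(i, n, m) \<in> phase_set P" "1 \<le> n" "1 \<le> i" "1 \<le> m"
    "\<And>n'. (i - 1, n', m - 1) \<in> phase_set P \<Longrightarrow> Q (i - 1, n', m - 1)" for i n m
    by (rule step'[OF rate_service[OF adm that(2,3,4), of k]]) (use that in auto)
  have wake: "Q (i, 0, m)"
    if "(i, 0, m) \<in> phase_set P" "1 \<le> max i m" "(i, 1, m) \<in> phase_set P \<Longrightarrow> Q (i, 1, m)" for i m
    by (rule step'[OF rate_vacation[OF adm, of 0 i m k]]) (use that c in auto)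
  have arrive: "Q (i, n, 0)"
    if "(i, n, 0) \<in> phase_set P" "(i, n, 1) \<in> phase_set P \<Longrightarrow> Q (i, n, 1)" for i n
    by (rule step'[OF rate_arrival[OF adm, of 0 k i n]]) (use that c in auto)
  have empty: "(i, n, 0) \<in> phase_set P \<Longrightarrow> Q (i, n, 0)" for i n
  proof (induction i arbitrary: n)
    case 0
    then have "n = 0" by (auto simp: phase_set_def)
    with base show ?case by simp
  next
    case (Suc i)
    have pos: "Q (Suc i, n, 0)" if "1 \<le> n" "(Suc i, n, 0) \<in> phase_set P" for n
      by (rule arrive[OF that(2)], rule serve) (use that Suc.IH in auto)
    show ?case
    proof (cases "n = 0")
      case True
      show ?thesis unfolding True
        by (rule wake) (use Suc.prems True pos in auto)
    qed (use pos Suc.prems in auto)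
  qed
  have "(i, n, m) \<in> phase_set P \<Longrightarrow> Q (i, n, m)" for i n m
  proof (induction m arbitrary: i n)
    case 0
    then show ?case by (rule empty)
  next
    case (Suc m)
    have pos: "Q (i, n, Suc m)" if "1 \<le> n" "1 \<le> i" "(i, n, Suc m) \<in> phase_set P" for i n
      by (rule serve) (use that Suc.IH in auto)
    have pos': "Q (i, n, Suc m)" if "1 \<le> i" "(i, n, Suc m) \<in> phase_set P" for i n
    proof (cases "n = 0")
      case True
      show ?thesis unfolding True by (rule wake) (use that True pos in auto)
    qed (use pos that in auto)
    show ?case
    proof (cases "i = 0")
      case True
      \<comment> \<open>Replenishment leaves the hall unchanged and makes the inventory positive,
        where \<open>pos'\<close> applies.\<close>
      have "0 < rate P (k, i, n, Suc m) (k, i + order_qty P, n, Suc m)"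
        by (rule rate_replenishment[OF adm]) (use True in simp)
      then show ?thesis by (rule step') (use Suc.prems pos' c in auto)
    qed (use pos' Suc.prems in auto)
  qed
  with assms(2) show ?thesis by (cases x) auto
qed

section \<open>Generator blocks as matrices over phase positions\<close>

lemma phases_nth: "a < nph P \<Longrightarrow> phases P ! a \<in> phase_set P"
  by (metis nph_def nth_mem set_phases)

lemma phases_index:
  assumes "x \<in> phase_set P"
  obtains a where "a < nph P" "phases P ! a = x"
  using assms by (metis nph_def in_set_conv_nth set_phases)

lemma phases_inj: "a < nph P \<Longrightarrow> b < nph P \<Longrightarrow> phases P ! a = phases P ! b \<Longrightarrow> a = b"
  using distinct_phases nph_def nth_eq_iff_index_eq by metis

lemma sum_phases: "(\<Sum>b<nph P. f (phases P ! b)) = (\<Sum>x\<in>phase_set P. f x)"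
  using bij_betw_nth[OF distinct_phases[of P], of "{..<nph P}" "phase_set P"]
  by (intro sum.reindex_bij_betw) (auto simp: nph_def set_phases)

lemma block_carr [simp]:
  "gen_block P k l \<in> carrier_mat (nph P) (nph P)" "H_up P \<in> carrier_mat (nph P) (nph P)"
  "H_down P k \<in> carrier_mat (nph P) (nph P)" "H_loc P k \<in> carrier_mat (nph P) (nph P)"
  by (auto simp: gen_block_def H_up_def H_down_def H_loc_def)

lemma gen_block_entry:
  "a < nph P \<Longrightarrow> b < nph P \<Longrightarrow> gen_block P k l $$ (a, b) = gen P (k, phases P ! a) (l, phases P ! b)"
  by (simp add: gen_block_def)

lemma gen_block_nonneg:
  assumes "admissible P" "k \<noteq> l"
  shows "0\<^sub>m (nph P) (nph P) \<le> gen_block P k l"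
proof (rule mat_leI)
  fix a b assume "a < nph P" "b < nph P"
  then show "(0\<^sub>m (nph P) (nph P) :: real mat) $$ (a, b) \<le> gen_block P k l $$ (a, b)"
    using assms(2) rate_nonneg[OF assms(1), of "(k, phases P ! a)" "(l, phases P ! b)"]
    by (simp add: gen_block_entry gen_def)
qed auto

lemma H_up_nonneg: "admissible P \<Longrightarrow> 0\<^sub>m (nph P) (nph P) \<le> H_up P"
  by (simp add: H_up_def gen_block_nonneg)

lemma H_down_nonneg: "admissible P \<Longrightarrow> 1 \<le> k \<Longrightarrow> 0\<^sub>m (nph P) (nph P) \<le> H_down P k"
  by (simp add: H_down_def gen_block_nonneg)

lemma H_loc_offdiag:
  assumes "a < nph P" "b < nph P" "a \<noteq> b"
  shows "H_loc P k $$ (a, b) = rate P (k, phases P ! a) (k, phases P ! b)"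
  using assms phases_inj[of a P b] by (auto simp: H_loc_def gen_block_entry gen_def)

lemma block_row_sums:
  assumes "a < nph P"
  shows "(\<Sum>l\<le>k + 1. \<Sum>b<nph P. gen_block P k l $$ (a, b)) = 0"
proof -
  have "(\<Sum>l\<le>k + 1. \<Sum>b<nph P. gen_block P k l $$ (a, b))
      = (\<Sum>l\<le>k + 1. \<Sum>y\<in>phase_set P. gen P (k, phases P ! a) (l, y))"
    using assms by (simp add: gen_block_entry sum_phases[of "\<lambda>y. gen P (k, phases P ! a) (_, y)", symmetric])
  also have "\<dots> = (\<Sum>y\<in>{..k + 1} \<times> phase_set P. gen P (k, phases P ! a) y)"
    by (simp add: sum.cartesian_product)
  also have "\<dots> = 0" by (rule gen_row_sum[OF phases_nth[OF assms]])
  finally show ?thesis .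
qed

lemma H_row_sums_0:
  assumes "a < nph P"
  shows "(\<Sum>b<nph P. H_loc P 0 $$ (a, b)) + (\<Sum>b<nph P. H_up P $$ (a, b)) = 0"
  using block_row_sums[OF assms, of 0] by (simp add: H_loc_def H_up_def)

lemma H_row_sums_pos:
  assumes adm: "admissible P" and a: "a < nph P" and k: "1 \<le> k"
  shows "(\<Sum>b<nph P. H_up P $$ (a, b)) + (\<Sum>b<nph P. H_loc P k $$ (a, b)) +
      (\<Sum>b<nph P. H_down P k $$ (a, b)) = 0"
proof -
  obtain k' where k': "k = Suc k'" using k by (cases k) auto
  \<comment> \<open>The orbit loses at most one customer at a time, so the blocks to levels below
    \<open>k - 1\<close> vanish and three blocks remain in the row sum.\<close>
  have "(\<Sum>b<nph P. gen_block P k l $$ (a, b)) = 0" if "l < k'" for l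
  proof (rule sum.neutral, clarify)
    fix b assume b: "b < nph P"
    have "rate P (k, phases P ! a) (l, phases P ! b) = 0"
      using rate_target(3)[OF adm phases_nth[OF a]] that k' by fastforce
    then show "gen_block P k l $$ (a, b) = 0"
      using a b that k' by (simp add: gen_block_entry gen_def)
  qed
  then have "(\<Sum>l<k'. \<Sum>b<nph P. gen_block P k l $$ (a, b)) = 0" by (intro sum.neutral) auto
  moreover have "{..k + 1} = insert (k + 1) (insert k (insert k' {..<k'}))" using k' by auto
  ultimately show ?thesis
    using block_row_sums[OF a, of k] gen_block_up[of P k] k'
    by (simp add: H_loc_def H_down_def)
qed

text \<open>Reachability carried over from phases to matrix positions, in the form that
  \<open>drain\<close> and \<open>reach\<close> ask for.\<close>

lemma H_loc_reach:
  assumes adm: "admissible P" and a: "a < nph P"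
    and base: "\<And>r. r < nph P \<Longrightarrow> phases P ! r = (0, 0, 0) \<Longrightarrow> C r"
    and step: "\<And>a b. a < nph P \<Longrightarrow> b < nph P \<Longrightarrow> a \<noteq> b \<Longrightarrow> 0 < H_loc P k $$ (a, b) \<Longrightarrow> C b \<Longrightarrow> C a"
  shows "C a"
proof -
  have "\<forall>a<nph P. phases P ! a = x \<longrightarrow> C a" if "x \<in> phase_set P" for x
    using adm that
  proof (induction rule: phase_reachability_induct[where k = k])
    case base
    then show ?case using assms(3) by blast
  next
    case (step x y)
    obtain b where b: "b < nph P" "phases P ! b = y" using phases_index step by metis
    show ?case
    proof (intro allI impI)
      fix a assume a: "a < nph P" "phases P ! a = x"
      show "C a"
      proof (rule assms(4)[OF a(1) b(1)])
        show "a \<noteq> b" using a b step by auto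
        then show "0 < H_loc P k $$ (a, b)" using H_loc_offdiag[OF a(1) b(1)] a b step by simp
      qed (use b step in auto)
    qed
  qed
  with phases_nth[OF a] a show ?thesis by blast
qed

text \<open>At \<open>(0, 0, 0)\<close> the hall has room, so for \<open>1 \<le> k\<close> a retrial
  lowers the orbit level. This is the exit required by \<open>drain\<close>.\<close>

lemma H_down_root:
  assumes adm: "admissible P" and "1 \<le> k" "r < nph P" "phases P ! r = (0, 0, 0)"
  shows "0 < (\<Sum>b<nph P. H_down P k $$ (r, b))"
proof -
  have "0 < hall_size P" using adm by (auto simp: admissible_def)
  then have pos: "0 < rate P (k, 0, 0, 0) (k - 1, 0, 0, 1)"
    using rate_retrial[OF adm \<open>1 \<le> k\<close>, of 0 0 0] by simp
  have "(0, 0, 0) \<in> phase_set P" by (simp add: phase_set_def)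
  then have "(0, 0, 1) \<in> phase_set P"
    using rate_target(1)[OF adm, of "(0, 0, 0)" k "k - 1" "(0, 0, 1)"] pos by simp
  then obtain b where b: "b < nph P" "phases P ! b = (0, 0, 1)" by (rule phases_index)
  have "0 < H_down P k $$ (r, b)"
    using pos b assms by (simp add: H_down_def gen_block_entry gen_def)
  moreover have "0 \<le> H_down P k $$ (r, j)" if "j < nph P" for j
    using mat_nonnegD[OF H_down_nonneg[OF adm \<open>1 \<le> k\<close>]] that assms by simp
  ultimately show ?thesis using b by (intro sum_pos2[of _ b]) auto
qed

text \<open>\<open>K * H_down P k\<close> plays the role of the first-passage matrix from level \<open>k\<close> to \<open>k - 1\<close>.\<close>

definition subinverse :: "qis_params \<Rightarrow> nat \<Rightarrow> real mat \<Rightarrow> bool" where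
  "subinverse P k K \<longleftrightarrow> K \<in> carrier_mat (nph P) (nph P) \<and> 0\<^sub>m (nph P) (nph P) \<le> K \<and>
     (\<forall>a<nph P. (\<Sum>b<nph P. (K * H_down P k) $$ (a, b)) \<le> 1)"

text \<open>For \<open>K = K_mat P M R (k + 1)\<close> this holds the rates at level \<open>k\<close> of the process watched only
  at levels up to \<open>k\<close>.\<close>

definition censored :: "qis_params \<Rightarrow> nat \<Rightarrow> real mat \<Rightarrow> real mat" where
  "censored P k K = H_loc P k + H_up P * K * H_down P (k + 1)"

section \<open>Level blocks and censored blocks as instances of \<open>qbd_blocks\<close>\<close>

lemma qbd_blocks_level:
  assumes adm: "admissible P" and k: "1 \<le> k"
  shows "qbd_blocks (nph P) (H_up P) (H_loc P k) (H_down P k)"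
proof
  fix a assume a: "a < nph P"
  show "(\<Sum>j<nph P. H_up P $$ (a, j)) + (\<Sum>j<nph P. H_loc P k $$ (a, j)) +
      (\<Sum>j<nph P. H_down P k $$ (a, j)) \<le> 0"
    using H_row_sums_pos[OF adm a k] by simp
next
  fix C :: "nat \<Rightarrow> bool" and a
  assume "\<And>b. b < nph P \<Longrightarrow> 0 < (\<Sum>j<nph P. H_down P k $$ (b, j)) \<Longrightarrow> C b"
    and "\<And>a b. a < nph P \<Longrightarrow> b < nph P \<Longrightarrow> a \<noteq> b \<Longrightarrow> 0 < H_loc P k $$ (a, b) \<Longrightarrow> C b \<Longrightarrow> C a"
    and "a < nph P"
  then show "C a" using H_loc_reach[OF adm, of a C k] H_down_root[OF adm k] by blast
qed (auto simp: H_up_nonneg[OF adm] H_down_nonneg[OF adm k] H_loc_offdiag rate_nonneg[OF adm])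

lemma censored_carr:
  "K \<in> carrier_mat (nph P) (nph P) \<Longrightarrow> censored P k K \<in> carrier_mat (nph P) (nph P)"
  unfolding censored_def by (intro add_carrier_mat mult_carrier_mat[where n = "nph P"] block_carr)

text \<open>Excursions above level \<open>k\<close> add the nonnegative term
  \<open>H_up P * K * H_down P (k + 1)\<close>. As \<open>K * H_down P (k + 1)\<close> is
  substochastic, the row sums of this term do not exceed those of \<open>H_up P\<close>.\<close>

lemma censored_props:
  assumes adm: "admissible P" and K: "subinverse P (k + 1) K" and a: "a < nph P"
  shows censored_ge: "b < nph P \<Longrightarrow> H_loc P k $$ (a, b) \<le> censored P k K $$ (a, b)"
    and censored_offdiag: "b < nph P \<Longrightarrow> a \<noteq> b \<Longrightarrow> 0 \<le> censored P k K $$ (a, b)"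
    and censored_row_sum: "(\<Sum>b<nph P. censored P k K $$ (a, b)) \<le>
      (\<Sum>b<nph P. H_loc P k $$ (a, b)) + (\<Sum>b<nph P. H_up P $$ (a, b))"
proof -
  let ?n = "nph P" and ?X = "H_up P * K * H_down P (k + 1)"
  have c: "K \<in> carrier_mat ?n ?n" "0\<^sub>m ?n ?n \<le> K" using K by (auto simp: subinverse_def)
  have X: "?X \<in> carrier_mat ?n ?n" by (intro mult_carrier_mat[where n = ?n] block_carr c)
  have X0: "0\<^sub>m ?n ?n \<le> ?X"
    by (intro mult_mat_nonneg[where n = ?n] mult_carrier_mat[where n = ?n] block_carr c
        H_up_nonneg[OF adm] H_down_nonneg[OF adm]) auto
  have e: "censored P k K $$ (a, b) = H_loc P k $$ (a, b) + ?X $$ (a, b)" if "b < ?n" for b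
    using that a carrier_matD[OF X] unfolding censored_def by (intro index_add_mat(1)) auto
  show ge: "H_loc P k $$ (a, b) \<le> censored P k K $$ (a, b)" if "b < ?n" for b
    using e[OF that] mat_nonnegD[OF X0 X a that] by simp
  show "0 \<le> censored P k K $$ (a, b)" if "b < ?n" "a \<noteq> b" for b
    using ge[OF that(1)] H_loc_offdiag[OF a that, of k] rate_nonneg[OF adm] by (metis order_trans)
  have "?X = H_up P * (K * H_down P (k + 1))"
    by (rule mat_assoc[where m = ?n and n = ?n]) (use c in auto)
  then have "(\<Sum>b<?n. ?X $$ (a, b)) = (\<Sum>c<?n. H_up P $$ (a, c) * (\<Sum>b<?n. (K * H_down P (k + 1)) $$ (c, b)))"
    by (simp only:, intro row_sum_mult[where nr = ?n]) (use a mult_carrier_mat[OF c(1)] in auto)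
  also have "\<dots> \<le> (\<Sum>c<?n. H_up P $$ (a, c) * 1)"
    by (intro sum_mono mult_left_mono)
       (use K mat_nonnegD[OF H_up_nonneg[OF adm] _ a] in \<open>auto simp: subinverse_def\<close>)
  finally show "(\<Sum>b<?n. censored P k K $$ (a, b)) \<le>
      (\<Sum>b<?n. H_loc P k $$ (a, b)) + (\<Sum>b<?n. H_up P $$ (a, b))"
    using e by (simp add: sum.distrib)
qed

text \<open>The upward block is zero because excursions are already folded into
  \<open>censored P k K\<close>. Paths along \<open>H_loc P k\<close> survive, since censoring does
  not decrease entries.\<close>

lemma qbd_blocks_censored:
  assumes adm: "admissible P" and k: "1 \<le> k" and K: "subinverse P (k + 1) K"
  shows "qbd_blocks (nph P) (0\<^sub>m (nph P) (nph P)) (censored P k K) (H_down P k)"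
proof
  show "censored P k K \<in> carrier_mat (nph P) (nph P)"
    using K by (intro censored_carr) (simp add: subinverse_def)
next
  fix a assume a: "a < nph P"
  show "(\<Sum>j<nph P. (0\<^sub>m (nph P) (nph P) :: real mat) $$ (a, j)) + (\<Sum>j<nph P. censored P k K $$ (a, j)) +
      (\<Sum>j<nph P. H_down P k $$ (a, j)) \<le> 0"
    using censored_row_sum[OF adm K a] H_row_sums_pos[OF adm a k] a by simp
next
  fix C :: "nat \<Rightarrow> bool" and a
  assume 1: "\<And>b. b < nph P \<Longrightarrow> 0 < (\<Sum>j<nph P. H_down P k $$ (b, j)) \<Longrightarrow> C b"
    and 2: "\<And>a b. a < nph P \<Longrightarrow> b < nph P \<Longrightarrow> a \<noteq> b \<Longrightarrow> 0 < censored P k K $$ (a, b) \<Longrightarrow> C b \<Longrightarrow> C a"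
    and "a < nph P"
  show "C a"
  proof (rule H_loc_reach[OF adm \<open>a < nph P\<close>, where k = k])
    show "C r" if "r < nph P" "phases P ! r = (0, 0, 0)" for r
      by (rule 1[OF that(1) H_down_root[OF adm k that]])
    show "C a" if "a < nph P" "b < nph P" "a \<noteq> b" "0 < H_loc P k $$ (a, b)" "C b" for a b
      using 2[OF that(1-3) less_le_trans[OF that(4) censored_ge[OF adm K that(1,2)]] that(5)] .
  qed
qed (auto simp: H_down_nonneg[OF adm k] censored_offdiag[OF adm K])

text \<open>\<open>H_up P * N\<close> is a nonnegative solution, so it dominates the minimal
  \<open>R\<close>; \<open>minimal_solution\<close> gives the converse. With this identity the facts
  about \<open>N\<close> become facts about \<open>R\<close>.\<close>

lemma minimal_solution_top:
  assumes adm: "admissible P" and M: "1 \<le> M" and R: "minimal_nonneg_solution P M R"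
  shows "R \<in> carrier_mat (nph P) (nph P)"
    and "\<exists>N. subinverse P M N \<and> R = H_up P * N \<and> N * (- (H_loc P M + R * H_down P M)) = 1\<^sub>m (nph P)"
    and "(\<And>k. \<Psi> k \<in> carrier_mat 1 (nph P)) \<Longrightarrow> (\<And>k. 0\<^sub>m 1 (nph P) \<le> \<Psi> k) \<Longrightarrow>
      (\<And>k. \<Psi> k * H_up P + \<Psi> (Suc k) * H_loc P M + \<Psi> (Suc (Suc k)) * H_down P M = 0\<^sub>m 1 (nph P)) \<Longrightarrow>
      (\<And>j. j < nph P \<Longrightarrow> (\<lambda>k. \<Psi> k $$ (0, j)) \<longlonglongrightarrow> 0) \<Longrightarrow> \<Psi> (Suc k) = \<Psi> k * R"
proof -
  interpret qbd_blocks "nph P" "H_up P" "H_loc P M" "H_down P M"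
    by (rule qbd_blocks_level[OF adm M])
  show Rc: "R \<in> carrier_mat (nph P) (nph P)"
    using R by (simp add: minimal_nonneg_solution_def nonneg_solution_def)
  have sq: "X ^\<^sub>m 2 = X * X" if "X \<in> carrier_mat (nph P) (nph P)" for X :: "real mat"
    using that by (simp add: numeral_2_eq_2 left_mult_one_mat[where nr = "nph P" and nc = "nph P"])
  have "0\<^sub>m (nph P) (nph P) \<le> H_up P * N"
    by (rule mult_mat_nonneg[where n = "nph P"]) (auto simp: H_up_nonneg[OF adm] N_nonneg)
  then have "nonneg_solution P M (H_up P * N)"
    using solution by (simp add: nonneg_solution_def sq)
  then have "R \<le> H_up P * N" using R by (simp add: minimal_nonneg_solution_def)
  moreover have "H_up P * N \<le> R"
    by (rule minimal_solution)
       (use R sq[OF Rc] in \<open>auto simp: minimal_nonneg_solution_def nonneg_solution_def\<close>)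
  ultimately have eq: "R = H_up P * N" by (rule order_antisym)
  show "\<exists>N. subinverse P M N \<and> R = H_up P * N \<and> N * (- (H_loc P M + R * H_down P M)) = 1\<^sub>m (nph P)"
    using eq N_inverse N_exit N_nonneg by (intro exI[of _ N]) (auto simp: subinverse_def)
  assume "\<And>k. \<Psi> k \<in> carrier_mat 1 (nph P)" "\<And>k. 0\<^sub>m 1 (nph P) \<le> \<Psi> k"
    "\<And>k. \<Psi> k * H_up P + \<Psi> (Suc k) * H_loc P M + \<Psi> (Suc (Suc k)) * H_down P M = 0\<^sub>m 1 (nph P)"
    "\<And>j. j < nph P \<Longrightarrow> (\<lambda>k. \<Psi> k $$ (0, j)) \<longlonglongrightarrow> 0"
  from sequence_recursion[of \<Psi>, OF this] show "\<Psi> (Suc k) = \<Psi> k * R" by (simp add: eq)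
qed

section \<open>The inverses defining the matrices \<open>K_mat P M R j\<close>\<close>

definition K_arg :: "qis_params \<Rightarrow> nat \<Rightarrow> real mat \<Rightarrow> nat \<Rightarrow> real mat" where
  "K_arg P M R j =
     (if j < M then censored P j (K_mat P M R (j + 1)) else H_loc P M + R * H_down P M)"

lemma K_mat_eq: "K_mat P M R j = minv (- K_arg P M R j)"
  by (subst K_mat.simps) (simp add: K_arg_def censored_def)

text \<open>Downward induction from \<open>M\<close>, where the inverse is the sojourn matrix of the
  homogeneous blocks. Below \<open>M\<close>, the property \<open>subinverse\<close> of
  \<open>K_mat P M R (j + 1)\<close> lets the censored blocks of level \<open>j\<close> satisfy
  \<open>qbd_blocks\<close>; their sojourn matrix is the next inverse and again a
  \<open>subinverse\<close>.\<close>

lemma K_mat_props: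
  assumes adm: "admissible P" and M: "1 \<le> M" and R: "minimal_nonneg_solution P M R"
    and j: "1 \<le> j" "j \<le> M"
  shows "subinverse P j (K_mat P M R j) \<and> K_arg P M R j \<in> carrier_mat (nph P) (nph P) \<and>
     invertible_mat (- K_arg P M R j) \<and> K_mat P M R j * (- K_arg P M R j) = 1\<^sub>m (nph P)"
  using j(2,1)
proof (induction j rule: inc_induct)
  case base
  obtain N where N: "subinverse P M N" "N * (- (H_loc P M + R * H_down P M)) = 1\<^sub>m (nph P)"
    using minimal_solution_top(2)[OF adm M R] by blast
  have c: "N \<in> carrier_mat (nph P) (nph P)" "- K_arg P M R M \<in> carrier_mat (nph P) (nph P)"
    using N minimal_solution_top(1)[OF adm M R]
    by (auto simp: subinverse_def K_arg_def intro!: add_carrier_mat mult_carrier_mat[where n = "nph P"])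
  have "K_mat P M R M = N" "invertible_mat (- K_arg P M R M)"
    using minv_left_inverse[OF c(2,1)] N(2) by (auto simp: K_mat_eq K_arg_def)
  with N c show ?case by (auto simp: K_arg_def)
next
  case (step j)
  then have K: "subinverse P (j + 1) (K_mat P M R (j + 1))" by simp
  interpret qbd_blocks "nph P" "0\<^sub>m (nph P) (nph P)" "K_arg P M R j" "H_down P j"
    using qbd_blocks_censored[OF adm step.prems K] step.hyps by (simp add: K_arg_def)
  \<comment> \<open>With a zero upward block the quadratic term drops out of
    \<open>N_inverse\<close>.\<close>
  have "0\<^sub>m (nph P) (nph P) * N * H_down P j = 0\<^sub>m (nph P) (nph P)"
    by (simp add: left_mult_zero_mat[where n = "nph P" and nc = "nph P"])
  then have inv: "N * (- K_arg P M R j) = 1\<^sub>m (nph P)"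
    using N_inverse by (simp add: right_add_zero_mat[where nr = "nph P" and nc = "nph P"])
  have "K_mat P M R j = N" "invertible_mat (- K_arg P M R j)"
    using minv_left_inverse[OF _ N_carr inv] by (simp_all add: K_mat_eq)
  then show ?case using inv N_nonneg N_exit by (simp add: subinverse_def)
qed

section \<open>Balance equations of a stationary distribution\<close>

text \<open>The generator is banded, so each infinite balance sum has only finitely many nonzero
  terms.\<close>

lemma sums_bandI:
  fixes f :: "nat \<Rightarrow> real"
  assumes "f sums s" "\<And>k. k \<notin> A \<Longrightarrow> f k = 0" "finite A"
  shows "sum f A = s"
  using sums_finite[of A f] assms by (metis sums_unique2)

lemma stationary_balance_0:
  assumes "1 \<le> M" "stationary_distribution P M \<Phi>"
  shows "\<Phi> 0 * H_loc P 0 + \<Phi> 1 * H_down P 1 = 0\<^sub>m 1 (nph P)"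
proof (rule eq_matI)
  have c: "\<Phi> k \<in> carrier_mat 1 (nph P)" for k using assms by (simp add: stationary_distribution_def)
  fix i b assume ib: "i < dim_row (0\<^sub>m 1 (nph P) :: real mat)" "b < dim_col (0\<^sub>m 1 (nph P) :: real mat)"
  have "(\<lambda>k. (\<Phi> k * trunc_gen P M k 0) $$ (0, b)) sums 0"
    using assms(2) ib by (simp add: stationary_distribution_def)
  then have "(\<Sum>k\<in>{0, 1}. (\<Phi> k * trunc_gen P M k 0) $$ (0, b)) = 0"
    by (rule sums_bandI)
       (use ib c in \<open>auto simp: trunc_gen_def right_mult_zero_mat[where nr = 1 and n = "nph P"]\<close>)
  then show "(\<Phi> 0 * H_loc P 0 + \<Phi> 1 * H_down P 1) $$ (i, b) = (0\<^sub>m 1 (nph P) :: real mat) $$ (i, b)"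
    using ib assms(1) carrier_matD[OF c] carrier_matD[OF block_carr(3)]
    by (simp add: trunc_gen_def min_def del: index_mult_mat(1))
qed (use assms carrier_matD[OF block_carr(3)] in \<open>auto simp: stationary_distribution_def\<close>)

lemma stationary_balance_Suc:
  assumes "stationary_distribution P M \<Phi>"
  shows "\<Phi> l * H_up P + \<Phi> (Suc l) * H_loc P (min (Suc l) M) +
     \<Phi> (Suc (Suc l)) * H_down P (min (Suc (Suc l)) M) = 0\<^sub>m 1 (nph P)"
proof (rule eq_matI)
  have c: "\<Phi> k \<in> carrier_mat 1 (nph P)" for k using assms by (simp add: stationary_distribution_def)
  fix i b assume ib: "i < dim_row (0\<^sub>m 1 (nph P) :: real mat)" "b < dim_col (0\<^sub>m 1 (nph P) :: real mat)"
  have "(\<lambda>k. (\<Phi> k * trunc_gen P M k (Suc l)) $$ (0, b)) sums 0"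
    using assms ib by (simp add: stationary_distribution_def)
  then have "(\<Sum>k\<in>{l, Suc l, Suc (Suc l)}. (\<Phi> k * trunc_gen P M k (Suc l)) $$ (0, b)) = 0"
    by (rule sums_bandI)
       (use ib c in \<open>auto simp: trunc_gen_def right_mult_zero_mat[where nr = 1 and n = "nph P"]\<close>)
  then show "(\<Phi> l * H_up P + \<Phi> (Suc l) * H_loc P (min (Suc l) M) +
     \<Phi> (Suc (Suc l)) * H_down P (min (Suc (Suc l)) M)) $$ (i, b) = (0\<^sub>m 1 (nph P) :: real mat) $$ (i, b)"
    using ib carrier_matD[OF c] carrier_matD[OF block_carr(2)] carrier_matD[OF block_carr(3)] carrier_matD[OF block_carr(4)]
    by (simp add: trunc_gen_def del: index_mult_mat(1))
qed (use assms carrier_matD[OF block_carr(3)] in \<open>auto simp: stationary_distribution_def\<close>)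

lemma mult_ones_entry:
  "v \<in> carrier_mat 1 (nph P) \<Longrightarrow> (v * ones P) $$ (0, 0) = (\<Sum>j<nph P. v $$ (0, j))"
  by (subst mult_mat_entry[where nr = 1 and nc = 1 and n = "nph P"]) (auto simp: ones_def)

text \<open>Each entry is at most the mass of its level, which is a term of a convergent
  series.\<close>

lemma stationary_vanishes:
  assumes "stationary_distribution P M \<Phi>" "j < nph P"
  shows "(\<lambda>k. \<Phi> k $$ (0, j)) \<longlonglongrightarrow> 0"
proof (rule tendsto_sandwich)
  have c: "\<Phi> k \<in> carrier_mat 1 (nph P)" "0\<^sub>m 1 (nph P) \<le> \<Phi> k" for k
    using assms by (auto simp: stationary_distribution_def)
  have nn: "0 \<le> \<Phi> k $$ (0, j)" if "j < nph P" for k j using mat_nonnegD[OF c(2,1)] that by simp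
  then show "\<forall>\<^sub>F k in sequentially. 0 \<le> \<Phi> k $$ (0, j)" using assms(2) by simp
  have "\<Phi> k $$ (0, j) \<le> (\<Phi> k * ones P) $$ (0, 0)" for k
    unfolding mult_ones_entry[OF c(1)]
    by (intro member_le_sum[of j "{..<nph P}" "\<lambda>j. \<Phi> k $$ (0, j)"]) (use nn assms(2) in auto)
  then show "\<forall>\<^sub>F k in sequentially. \<Phi> k $$ (0, j) \<le> (\<Phi> k * ones P) $$ (0, 0)" by simp
  show "(\<lambda>k. (\<Phi> k * ones P) $$ (0, 0)) \<longlonglongrightarrow> 0"
    using assms(1) by (intro summable_LIMSEQ_zero) (auto simp: stationary_distribution_def sums_iff)
qed auto

text \<open>From level \<open>M\<close> on the blocks are constant, so the sequence shifted by
  \<open>M\<close> satisfies homogeneous balance equations.\<close>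

lemma stationary_top:
  assumes "admissible P" "1 \<le> M" "stationary_distribution P M \<Phi>" "minimal_nonneg_solution P M R"
  shows "\<Phi> (M + Suc k) = \<Phi> (M + k) * R"
  unfolding add_Suc_right
proof (rule minimal_solution_top(3)[of P M R "\<lambda>k. \<Phi> (M + k)", OF assms(1,2,4), unfolded add_Suc_right])
  show "\<Phi> (M + k) * H_up P + \<Phi> (Suc (M + k)) * H_loc P M +
      \<Phi> (Suc (Suc (M + k))) * H_down P M = 0\<^sub>m 1 (nph P)" for k
    using stationary_balance_Suc[OF assms(3), of "M + k"] by (simp add: min_def)
  show "(\<lambda>k. \<Phi> (M + k) $$ (0, j)) \<longlonglongrightarrow> 0" if "j < nph P" for j
    using LIMSEQ_ignore_initial_segment[OF stationary_vanishes[OF assms(3) that], of M] by (simp add: add.commute)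
qed (use assms(3) in \<open>auto simp: stationary_distribution_def\<close>)

text \<open>Downward induction: once \<open>\<Phi> (j + 1)\<close> is expressed through
  \<open>\<Phi> j\<close>, the balance equation of level \<open>j\<close> involves only
  \<open>\<Phi> (j - 1)\<close> and \<open>\<Phi> j\<close> and can be solved for the
  latter.\<close>

lemma stationary_step:
  assumes adm: "admissible P" and M: "1 \<le> M" and st: "stationary_distribution P M \<Phi>"
    and R: "minimal_nonneg_solution P M R"
    and j: "1 \<le> j" "j \<le> M"
  shows "\<Phi> j = \<Phi> (j - 1) * (H_up P * K_mat P M R j)"
proof -
  let ?n = "nph P"
  have c: "\<Phi> k \<in> carrier_mat 1 ?n" for k using st by (simp add: stationary_distribution_def)
  \<comment> \<open>\<open>Z\<close> is the return flow from above: \<open>R * H_down P M\<close> at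
    the top, \<open>H_up P * K_mat P M R (Suc j) * H_down P (Suc j)\<close> below it.\<close>
  have from_balance: "\<Phi> j = \<Phi> (j - 1) * (H_up P * K_mat P M R j)"
    if j: "1 \<le> j" "j \<le> M" and Z: "Z \<in> carrier_mat ?n ?n" "K_arg P M R j = H_loc P j + Z"
      and up: "\<Phi> (Suc j) * H_down P (min (Suc j) M) = \<Phi> j * Z" for j Z
  proof -
    let ?A = "- K_arg P M R j" and ?K = "K_mat P M R j"
    have K: "?K \<in> carrier_mat ?n ?n" "?K * ?A = 1\<^sub>m ?n" and A: "?A \<in> carrier_mat ?n ?n"
      using K_mat_props[OF adm M R j] by (auto simp: subinverse_def)
    have AK: "?A * ?K = 1\<^sub>m ?n" by (rule mat_mult_left_right_inverse[OF K(1) A K(2)])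
    have bal: "\<Phi> (j - 1) * H_up P + \<Phi> j * H_loc P j + \<Phi> j * Z = 0\<^sub>m 1 ?n"
      using stationary_balance_Suc[OF st, of "j - 1"] j up by (simp add: min_def)
    have A': "\<Phi> j * ?A = - (\<Phi> j * H_loc P j + \<Phi> j * Z)"
      unfolding Z(2) using c[of j] Z(1)
      by (simp add: mat_distrib[where m = 1 and n = ?n] carrier_matD[OF Z(1)])
    have "\<Phi> (j - 1) * H_up P = \<Phi> j * ?A"
    proof (rule eq_matI)
      fix i b assume "i < dim_row (\<Phi> j * ?A)" "b < dim_col (\<Phi> j * ?A)"
      then have ib: "i = 0" "b < ?n" using carrier_matD[OF c] carrier_matD[OF A] by auto
      have "(\<Phi> (j - 1) * H_up P + \<Phi> j * H_loc P j + \<Phi> j * Z) $$ (0, b) = 0"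
        unfolding bal using ib by simp
      then show "(\<Phi> (j - 1) * H_up P) $$ (i, b) = (\<Phi> j * ?A) $$ (i, b)"
        unfolding A' using ib carrier_matD[OF c] carrier_matD[OF Z(1)]
          carrier_matD[OF block_carr(2)] carrier_matD[OF block_carr(4)]
        by (simp del: index_mult_mat(1))
    qed (use carrier_matD[OF c] carrier_matD[OF A] carrier_matD[OF block_carr(2)] in auto)
    then have "\<Phi> (j - 1) * H_up P * ?K = \<Phi> j * (?A * ?K)"
      using c[of j] A K by (simp add: mat_assoc[where m = 1 and n = ?n])
    also have "\<dots> = \<Phi> j" unfolding AK using c[of j] by (simp add: right_mult_one_mat[where nr = 1 and nc = ?n])
    finally show ?thesis
      using c[of "j - 1"] K by (simp add: mat_assoc[where m = 1 and n = ?n])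
  qed
  show ?thesis
    using j(2,1)
  proof (induction j rule: inc_induct)
    case base
    have Rc: "R \<in> carrier_mat ?n ?n" by (rule minimal_solution_top(1)[OF adm M R])
    show ?case
    proof (rule from_balance[where Z = "R * H_down P M"])
      show "\<Phi> (Suc M) * H_down P (min (Suc M) M) = \<Phi> M * (R * H_down P M)"
        using stationary_top[OF adm M st R, of 0] c[of M] Rc
        by (simp add: mat_assoc[where m = 1 and n = ?n])
    qed (use M Rc in \<open>auto simp: K_arg_def intro!: mult_carrier_mat[where n = ?n]\<close>)
  next
    case (step j)
    have Kc: "K_mat P M R (Suc j) \<in> carrier_mat ?n ?n"
      using K_mat_props[OF adm M R, of "Suc j"] step.hyps by (simp add: subinverse_def)
    then have HK: "H_up P * K_mat P M R (Suc j) \<in> carrier_mat ?n ?n" by (intro mult_carrier_mat[where n = ?n]) auto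
    show ?case
    proof (rule from_balance[where Z = "H_up P * K_mat P M R (Suc j) * H_down P (Suc j)"])
      have "\<Phi> (Suc j) = \<Phi> j * (H_up P * K_mat P M R (Suc j))" using step.IH by simp
      then show "\<Phi> (Suc j) * H_down P (min (Suc j) M) = \<Phi> j * (H_up P * K_mat P M R (Suc j) * H_down P (Suc j))"
        using step.hyps HK c[of j] by (simp add: min_def mat_assoc[where m = 1 and n = ?n])
    qed (use step.hyps step.prems HK in
        \<open>auto simp: K_arg_def censored_def intro!: mult_carrier_mat[where n = ?n]\<close>)
  qed
qed

section \<open>Product form of the level vectors\<close>

lemma Omega_carr:
  assumes "admissible P" "1 \<le> M" "minimal_nonneg_solution P M R" "k \<le> M"
  shows "Omega P M R k \<in> carrier_mat (nph P) (nph P)"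
  using assms(4)
proof (induction k)
  case (Suc k)
  have "K_mat P M R (Suc k) \<in> carrier_mat (nph P) (nph P)"
    using K_mat_props[OF assms(1,2,3), of "Suc k"] Suc.prems by (simp add: subinverse_def)
  with Suc show ?case by (auto intro!: mult_carrier_mat[where n = "nph P"])
qed simp

lemma stationary_level_vector:
  assumes "admissible P" "1 \<le> M" "stationary_distribution P M \<Phi>" "minimal_nonneg_solution P M R"
  shows "\<Phi> k = level_vector P M R (\<Phi> 0) k"
proof -
  let ?n = "nph P"
  have c: "\<Phi> k \<in> carrier_mat 1 ?n" for k using assms(3) by (simp add: stationary_distribution_def)
  have low: "\<Phi> k = \<Phi> 0 * Omega P M R k" if "k \<le> M" for k
    using that
  proof (induction k)
    case 0
    then show ?case using c[of 0] by (simp add: right_mult_one_mat[where nr = 1 and nc = ?n])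
  next
    case (Suc k)
    have "K_mat P M R (Suc k) \<in> carrier_mat ?n ?n"
      using K_mat_props[OF assms(1,2,4), of "Suc k"] Suc.prems by (simp add: subinverse_def)
    then have HK: "H_up P * K_mat P M R (Suc k) \<in> carrier_mat ?n ?n" by (intro mult_carrier_mat[where n = ?n]) auto
    have "\<Phi> (Suc k) = \<Phi> k * (H_up P * K_mat P M R (Suc k))"
      using stationary_step[OF assms(1,2,3,4), of "Suc k"] Suc.prems by simp
    also have "\<Phi> k = \<Phi> 0 * Omega P M R k" using Suc by simp
    finally show ?case
      using c[of 0] HK Omega_carr[OF assms(1,2,4), of k] Suc.prems
      by (simp add: mat_assoc[where m = 1 and n = ?n])
  qed
  have Rc: "R \<in> carrier_mat ?n ?n" by (rule minimal_solution_top(1)[OF assms(1,2,4)])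
  have high: "\<Phi> (M + k) = \<Phi> M * R ^\<^sub>m k" for k
  proof (induction k)
    case 0
    then show ?case using c[of M] Rc by (simp add: right_mult_one_mat[where nr = 1 and nc = ?n])
  next
    case (Suc k)
    then show ?case
      using stationary_top[OF assms, of k] c[of M] Rc
      by (simp add: mat_assoc[where m = 1 and n = ?n])
  qed
  show ?thesis
  proof (cases "k \<le> M")
    case True
    then show ?thesis using low[of k] by (simp add: level_vector_def)
  next
    case False
    then show ?thesis using high[of "k - M"] low[of M] by (simp add: level_vector_def)
  qed
qed

lemma level_vector_smult:
  assumes "admissible P" "1 \<le> M" "minimal_nonneg_solution P M R" "v \<in> carrier_mat 1 (nph P)"
  shows "level_vector P M R (c \<cdot>\<^sub>m v) k = c \<cdot>\<^sub>m level_vector P M R v k"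
proof -
  let ?n = "nph P"
  have Rc: "R ^\<^sub>m j \<in> carrier_mat ?n ?n" for j using minimal_solution_top(1)[OF assms(1-3)] by simp
  have O: "c \<cdot>\<^sub>m v * Omega P M R j = c \<cdot>\<^sub>m (v * Omega P M R j)" if "j \<le> M" for j
    by (rule mult_smult_assoc_mat[OF assms(4) Omega_carr[OF assms(1-3) that]])
  show ?thesis
    using O[of k] O[of M] mult_smult_assoc_mat[OF mult_carrier_mat[OF assms(4) Omega_carr[OF assms(1-3), of M]] Rc]
    by (simp add: level_vector_def)
qed

section \<open>The linear system for level 0 and its unique normalized solution\<close>

lemma level_0_matrix:
  assumes "admissible P" "1 \<le> M" "minimal_nonneg_solution P M R"
  shows "H_loc P 0 + Omega P M R 1 * H_down P 1 = censored P 0 (K_mat P M R 1)"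
proof -
  have "K_mat P M R 1 \<in> carrier_mat (nph P) (nph P)"
    using K_mat_props[OF assms, of 1] assms(2) by (simp add: subinverse_def)
  then have "H_up P * K_mat P M R 1 \<in> carrier_mat (nph P) (nph P)"
    by (intro mult_carrier_mat[where n = "nph P"]) auto
  then show ?thesis
    by (simp add: censored_def left_mult_one_mat[where nr = "nph P" and nc = "nph P"])
qed

text \<open>This is the balance equation of level 0 with \<open>\<Phi> 1\<close> replaced by
  \<open>\<Phi> 0 * (H_up P * K_mat P M R 1)\<close>.\<close>

lemma level_0_null:
  assumes adm: "admissible P" and M: "1 \<le> M" and st: "stationary_distribution P M \<Phi>"
    and R: "minimal_nonneg_solution P M R"
  shows "\<Phi> 0 * censored P 0 (K_mat P M R 1) = 0\<^sub>m 1 (nph P)"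
proof -
  let ?n = "nph P"
  have c: "\<Phi> 0 \<in> carrier_mat 1 ?n" using st by (simp add: stationary_distribution_def)
  have K: "K_mat P M R 1 \<in> carrier_mat ?n ?n"
    using K_mat_props[OF adm M R, of 1] M by (simp add: subinverse_def)
  have "\<Phi> 0 * censored P 0 (K_mat P M R 1) =
      \<Phi> 0 * H_loc P 0 + \<Phi> 0 * (H_up P * K_mat P M R 1) * H_down P 1"
    unfolding censored_def using c K mult_carrier_mat[OF block_carr(2) K]
      mult_carrier_mat[OF mult_carrier_mat[OF block_carr(2) K] block_carr(3)]
    by (simp add: mat_distrib[where m = 1 and n = ?n]
        mat_assoc[where m = 1 and n = ?n])
  also have "\<Phi> 0 * (H_up P * K_mat P M R 1) = \<Phi> 1"
    using stationary_step[OF adm M st R, of 1] M by simp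
  also have "\<Phi> 0 * H_loc P 0 + \<Phi> 1 * H_down P 1 = 0\<^sub>m 1 ?n"
    by (rule stationary_balance_0[OF M st])
  finally show ?thesis .
qed

text \<open>In the process watched at level 0 nothing lies below, so \<open>H_row_sums_0\<close>
  makes its row sums nonpositive, and \<open>(0, 0, 0)\<close> can serve as the root in
  \<open>left_null_vector_eq_0\<close>.\<close>

lemma level_0_null_root:
  assumes adm: "admissible P" and M: "1 \<le> M" and R: "minimal_nonneg_solution P M R"
    and v: "v \<in> carrier_mat 1 (nph P)" "v * censored P 0 (K_mat P M R 1) = 0\<^sub>m 1 (nph P)"
    and r: "r < nph P" "phases P ! r = (0, 0, 0)" "v $$ (0, r) = 0"
  shows "v = 0\<^sub>m 1 (nph P)"
proof (rule left_null_vector_eq_0[OF _ v])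
  have K: "subinverse P (0 + 1) (K_mat P M R 1)"
    using K_mat_props[OF adm M R, of 1] M by simp
  then show "censored P 0 (K_mat P M R 1) \<in> carrier_mat (nph P) (nph P)"
    by (intro censored_carr) (simp add: subinverse_def)
  show "0 \<le> censored P 0 (K_mat P M R 1) $$ (i, j)" if "i < nph P" "j < nph P" "i \<noteq> j" for i j
    by (rule censored_offdiag[OF adm K that])
  show "(\<Sum>j<nph P. censored P 0 (K_mat P M R 1) $$ (i, j)) \<le> 0" if "i < nph P" for i
    using censored_row_sum[OF adm K that] H_row_sums_0[OF that] by simp
  show "v $$ (0, r) = 0" by (rule r)
  fix C :: "nat \<Rightarrow> bool" and a
  assume "C r"
    and step: "\<And>a b. a < nph P \<Longrightarrow> b < nph P \<Longrightarrow> a \<noteq> b \<Longrightarrow>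
      0 < censored P 0 (K_mat P M R 1) $$ (a, b) \<Longrightarrow> C b \<Longrightarrow> C a"
    and "a < nph P"
  show "C a"
  proof (rule H_loc_reach[OF adm \<open>a < nph P\<close>, where k = 0])
    show "C r'" if "r' < nph P" "phases P ! r' = (0, 0, 0)" for r'
      using phases_inj[OF that(1) r(1)] that r \<open>C r\<close> by simp
    show "C a" if "a < nph P" "b < nph P" "a \<noteq> b" "0 < H_loc P 0 $$ (a, b)" "C b" for a b
      using step[OF that(1-3) less_le_trans[OF that(4) censored_ge[OF adm K that(1,2)]] that(5)] .
  qed
qed

text \<open>A null vector is determined by its entry at the phase \<open>(0, 0, 0)\<close>, so
  \<open>v\<close> is a multiple of \<open>\<Phi> 0\<close>. The total mass is linear in the
  multiple, and normalization fixes it to 1.\<close>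

lemma level_0_unique:
  assumes adm: "admissible P" and M: "1 \<le> M" and st: "stationary_distribution P M \<Phi>"
    and R: "minimal_nonneg_solution P M R"
    and v: "v \<in> carrier_mat 1 (nph P)"
    and null: "v * censored P 0 (K_mat P M R 1) = 0\<^sub>m 1 (nph P)"
    and norm: "(\<lambda>k. (level_vector P M R v k * ones P) $$ (0, 0)) sums 1"
  shows "v = \<Phi> 0"
proof -
  let ?n = "nph P" and ?V = "censored P 0 (K_mat P M R 1)"
  have c: "\<Phi> k \<in> carrier_mat 1 ?n" for k using st by (simp add: stationary_distribution_def)
  have V: "?V \<in> carrier_mat ?n ?n"
    using K_mat_props[OF adm M R, of 1] M by (intro censored_carr) (simp add: subinverse_def)
  have ones: "ones P \<in> carrier_mat ?n 1" by (simp add: ones_def)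
  have scaled: "(\<lambda>k. (level_vector P M R (x \<cdot>\<^sub>m \<Phi> 0) k * ones P) $$ (0, 0)) sums x" for x
  proof -
    have "level_vector P M R (x \<cdot>\<^sub>m \<Phi> 0) k = x \<cdot>\<^sub>m \<Phi> k" for k
      using level_vector_smult[OF adm M R c] stationary_level_vector[OF adm M st R] by metis
    moreover have "(x \<cdot>\<^sub>m \<Phi> k * ones P) $$ (0, 0) = x * (\<Phi> k * ones P) $$ (0, 0)" for k
      using mult_smult_assoc_mat[OF c ones, of x k] carrier_matD[OF c] carrier_matD[OF ones]
      by (simp del: index_mult_mat(1))
    moreover have "(\<lambda>k. x * (\<Phi> k * ones P) $$ (0, 0)) sums (x * 1)"
      using st by (intro sums_mult) (simp add: stationary_distribution_def)
    ultimately show ?thesis by simp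
  qed
  have "(0, 0, 0) \<in> phase_set P" by (simp add: phase_set_def)
  then obtain r where r: "r < ?n" "phases P ! r = (0, 0, 0)" by (rule phases_index)
  \<comment> \<open>Otherwise \<open>\<Phi> 0\<close> vanishes, and its multiples by 1 and by 0
    coincide although their level vectors have total masses 1 and 0.\<close>
  have ne: "\<Phi> 0 $$ (0, r) \<noteq> 0"
  proof
    assume "\<Phi> 0 $$ (0, r) = 0"
    then have "\<Phi> 0 = 0\<^sub>m 1 ?n"
      by (rule level_0_null_root[OF adm M R c level_0_null[OF adm M st R] r])
    then have "1 \<cdot>\<^sub>m \<Phi> 0 = 0 \<cdot>\<^sub>m \<Phi> 0" by auto
    then show False using scaled[of 1] scaled[of 0] sums_unique2 by fastforce
  qed
  \<comment> \<open>The scalar is chosen to make \<open>u\<close> vanish at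
    \<open>r\<close>.\<close>
  define x where "x = v $$ (0, r) / \<Phi> 0 $$ (0, r)"
  define u where "u = v - x \<cdot>\<^sub>m \<Phi> 0"
  have u: "u \<in> carrier_mat 1 ?n" unfolding u_def by (intro minus_carrier_mat smult_carrier_mat c)
  have "u * ?V = v * ?V - (x \<cdot>\<^sub>m \<Phi> 0) * ?V"
    unfolding u_def by (rule minus_mult_distrib_mat[OF v _ V]) (use c in simp)
  also have "(x \<cdot>\<^sub>m \<Phi> 0) * ?V = x \<cdot>\<^sub>m (\<Phi> 0 * ?V)" by (rule mult_smult_assoc_mat[OF c V])
  finally have "u * ?V = 0\<^sub>m 1 ?n" unfolding null level_0_null[OF adm M st R] by auto
  moreover have "u $$ (0, r) = 0"
    using ne r carrier_matD[OF v] carrier_matD[OF c] by (simp add: u_def x_def)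
  ultimately have "u = 0\<^sub>m 1 ?n" by (rule level_0_null_root[OF adm M R u _ r])
  have v_eq: "v = x \<cdot>\<^sub>m \<Phi> 0"
  proof (rule eq_matI)
    fix i j assume "i < dim_row (x \<cdot>\<^sub>m \<Phi> 0)" "j < dim_col (x \<cdot>\<^sub>m \<Phi> 0)"
    then have ij: "i = 0" "j < ?n" using carrier_matD[OF c] by auto
    have "u $$ (0, j) = 0" using \<open>u = 0\<^sub>m 1 ?n\<close> ij by simp
    then show "v $$ (i, j) = (x \<cdot>\<^sub>m \<Phi> 0) $$ (i, j)"
      using ij carrier_matD[OF v] carrier_matD[OF c] by (simp add: u_def)
  qed (use carrier_matD[OF v] carrier_matD[OF c] in auto)
  then have "x = 1" using norm scaled[of x] sums_unique2 by metis
  with v_eq show ?thesis by auto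
qed

text \<open>Invertibility is part of the claim because \<open>minv\<close> is unspecified on
  singular matrices. The final equivalence says that the normalized linear system determines
  \<open>\<Phi> 0\<close>: it is the only solution among all row vectors, of whatever sign.\<close>

theorem theorem5:
  fixes P :: qis_params and M :: nat and \<Phi> :: "nat \<Rightarrow> real mat" and R :: "real mat"
  assumes "admissible P"
    and "1 \<le> M"
    and "stationary_distribution P M \<Phi>"
    and "minimal_nonneg_solution P M R"
  shows "invertible_mat (- (H_loc P M + R * H_down P M)) \<and>
     (\<forall>j\<in>{1..<M}. invertible_mat
        (- (H_loc P j + H_up P * K_mat P M R (j + 1) * H_down P (j + 1)))) \<and>
     (\<forall>k. \<Phi> k = level_vector P M R (\<Phi> 0) k) \<and>
     (\<forall>v\<in>carrier_mat 1 (nph P).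
        v * (H_loc P 0 + Omega P M R 1 * H_down P 1) = 0\<^sub>m 1 (nph P) \<and>
        (\<lambda>k. (level_vector P M R v k * ones P) $$ (0, 0)) sums 1
        \<longleftrightarrow> v = \<Phi> 0)"
proof (intro conjI ballI allI iffI; (elim conjE)?)
  show "invertible_mat (- (H_loc P M + R * H_down P M))"
    using K_mat_props[OF assms(1,2,4), of M] assms(2) by (simp add: K_arg_def)
  show "invertible_mat (- (H_loc P j + H_up P * K_mat P M R (j + 1) * H_down P (j + 1)))"
    if "j \<in> {1..<M}" for j
    using K_mat_props[OF assms(1,2,4), of j] that by (simp add: K_arg_def censored_def)
  show level: "\<Phi> k = level_vector P M R (\<Phi> 0) k" for k
    by (rule stationary_level_vector[OF assms])
  fix v
  show "v = \<Phi> 0" if "v \<in> carrier_mat 1 (nph P)"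
    "v * (H_loc P 0 + Omega P M R 1 * H_down P 1) = 0\<^sub>m 1 (nph P)"
    "(\<lambda>k. (level_vector P M R v k * ones P) $$ (0, 0)) sums 1"
    using level_0_unique[OF assms that(1)] that(2,3) level_0_matrix[OF assms(1,2,4)] by simp
  assume v: "v = \<Phi> 0"
  show "v * (H_loc P 0 + Omega P M R 1 * H_down P 1) = 0\<^sub>m 1 (nph P)"
    unfolding v level_0_matrix[OF assms(1,2,4)] by (rule level_0_null[OF assms])
  show "(\<lambda>k. (level_vector P M R v k * ones P) $$ (0, 0)) sums 1"
    using assms(3) unfolding v level[symmetric] by (simp add: stationary_distribution_def)
qed

end
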